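(* Let $s\in\mathbb N$ and let $\mathcal H=\{X_1,\dots,X_m\}$ be a family of vector fields on $\mathbb R^n$ of class $C^1\cap C^{s-1,1}_{\mathcal H,\mathrm{loc}}$. If $1\le\ell\le s-1$, then the following two statements are equivalent and true. (i) For every word $w$ of length $\ell$ and every $\psi\in C^1(\mathbb R^n)\cap C^{\ell,1}_{\mathcal H,\mathrm{loc}}$ we have $X_w\psi=X_w^\sharp\psi$. (ii) For every vector field $Z=\psi\cdot\nabla$ of class $C^1\cap C^{\ell,1}_{\mathcal H,\mathrm{loc}}$ and every word $w$ of length $\ell$ we have $\operatorname{ad}_ZX_w\,\varphi=[Z,X_w]\varphi$ for all $\varphi\in C^1(\mathbb R^n)$.
   Context: Write $X_j=f_j\cdot\nabla$ with $f_j:\mathbb R^n\to\mathbb R^n$; $e^{tX}x$ is the (local) flow of a $C^1$ vector field. Lie derivative: $X^\sharp g(x):=\lim_{t\to0}\frac1t(g(e^{tX}x)-g(x))$ (componentwise for vector valued $g$). Regularity class: let $d(x,y):=\inf\{r>0:\ y=e^{t_1Z_1}\cdots e^{t_\mu Z_\mu}x$ for some $\mu\in\mathbb N$, $\sum_j|t_j|\le1$, $Z_j\in\{rX_1,\dots,rX_m\}\}$ ($=+\infty$ if there are none). $g$ is $d$-Lipschitz on $A$ if $\sup_{x\neq y\in A}|g(x)-g(y)|/d(x,y)<\infty$. $g\in C^{k,1}_{\mathcal H,\mathrm{loc}}$ means that all derivatives $X_{j_1}^\sharp\cdots X_{j_k}^\sharp g$ exist and are $d$-Lipschitz on each Euclidean-bounded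 set. A vector field is in a class if its coefficients are. $C^1$ is Euclidean $C^1$. Commutators: a word $w=w_1\cdots w_\ell$ has letters in $\{1,\dots,m\}$ and length $|w|=\ell$. For $\sigma\in\mathfrak S_\ell$ put $\sigma_i(w):=w_{\sigma(i)}$. Define $\pi_\ell:\mathfrak S_\ell\to\{-1,0,1\}$ by $\pi_1=1$ and, for $\tau\in\mathfrak S_{\ell+1}$: if $\tau(1)=1$ then $\pi_{\ell+1}(\tau)=\pi_\ell(\sigma)$ with $\sigma(i)=\tau(i+1)-1$; if $\tau(\ell+1)=1$ then $\pi_{\ell+1}(\tau)=-\pi_\ell(\sigma)$ with $\sigma(i)=\tau(i)-1$; otherwise $\pi_{\ell+1}(\tau)=0$. For $|w|=\ell\le s$, $$f_w:=\sum_{\sigma\in\mathfrak S_\ell}\pi_\ell(\sigma)X^\sharp_{\sigma_1(w)}\cdots X^\sharp_{\sigma_{\ell-1}(w)}f_{\sigma_\ell(w)},\qquad X_w\psi:=f_w\cdot\nabla\psi\ \ (\psi\in C^1),$$ and for $|w|=\ell\le s-1$ and $\psi$ having $d$-continuous horizontal derivatives up to order $\ell$, $$X_w^\sharp\psi:=\sum_{\sigma\in\mathfrak S_\ell}\pi_\ell(\sigma)X^\sharp_{\sigma_1(w)}\cdots X^\sharp_{\sigma_\ell(w)}\psi .$$ For $Z=\psi\cdot\nabla$ as in (ii): $\operatorname{ad}_ZX_w:=(Z^\sharp f_w-X_w\psi)\cdot\nabla$ and $[Z,X_w]:=(Z^\sharp f_w-X_w^\sharp\psi)\cdot\nabla$,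 where $X_w\psi:=f_w\cdot\nabla\psi$ and $X_w^\sharp\psi$ act componentwise on the coefficient vector $\psi$ of $Z$, and $Z^\sharp f_w$ is the Lie derivative of $f_w$ along $Z$. *)

theory Defs
  imports "HOL-Analysis.Analysis" "HOL-Combinatorics.Permutations"
begin

text \<open>A vector field \<open>X = f \<cdot> \<nabla>\<close> is represented by its coefficient function
  \<open>f\<close>; a family \<open>X\<^sub>1, \<dots>, X\<^sub>m\<close> by \<open>f :: nat \<Rightarrow> 'a \<Rightarrow> 'a\<close>, of which only the
  indices in \<open>{1..m}\<close> matter. Vector valued functions are treated as a whole; all notions
  below agree with their componentwise versions.\<close>

definition C1 :: "('a::euclidean_space \<Rightarrow> 'b::euclidean_space) \<Rightarrow> bool" where
  "C1 g \<longleftrightarrow> (\<exists>g'. (\<forall>x. (g has_derivative blinfun_apply (g' x)) (at x)) \<and> continuous_on UNIV g')"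

definition vf_apply :: "('a::euclidean_space \<Rightarrow> 'a) \<Rightarrow> ('a \<Rightarrow> 'b::euclidean_space) \<Rightarrow> 'a \<Rightarrow> 'b" where
  "vf_apply f \<psi> x = frechet_derivative \<psi> (at x) (f x)"  \<comment> \<open>\<open>(f \<cdot> \<nabla>\<psi>)(x)\<close>\<close>

subsection \<open>Local flows and Lie derivatives\<close>

text \<open>\<open>flows_to f t x y\<close>: the integral curve of \<open>f\<close> from \<open>x\<close> exists up to time \<open>t\<close>
  (of either sign) and ends in \<open>y\<close>. The curve, hence \<open>y\<close>, is unique if \<open>f\<close> is \<open>C\<^sup>1\<close>.\<close>

definition flows_to :: "('a::euclidean_space \<Rightarrow> 'a) \<Rightarrow> real \<Rightarrow> 'a \<Rightarrow> 'a \<Rightarrow> bool" where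
  "flows_to f t x y \<longleftrightarrow> (\<exists>\<gamma>. \<gamma> 0 = x \<and> \<gamma> t = y \<and>
     (\<forall>u\<in>closed_segment 0 t. (\<gamma> has_vector_derivative f (\<gamma> u)) (at u within closed_segment 0 t)))"

definition flow :: "('a::euclidean_space \<Rightarrow> 'a) \<Rightarrow> real \<Rightarrow> 'a \<Rightarrow> 'a" where
  "flow f t x = (THE y. flows_to f t x y)"

text \<open>For \<open>C\<^sup>1\<close> fields \<open>flow f t x\<close> is meaningful for all \<open>t\<close> near \<open>0\<close>, which is all
  that the limits below depend on.\<close>

definition has_lie_deriv ::
  "('a::euclidean_space \<Rightarrow> 'a) \<Rightarrow> ('a \<Rightarrow> 'b::euclidean_space) \<Rightarrow> 'a \<Rightarrow> 'b \<Rightarrow> bool" where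
  "has_lie_deriv f g x l \<longleftrightarrow> ((\<lambda>t. (1 / t) *\<^sub>R (g (flow f t x) - g x)) \<longlongrightarrow> l) (at 0)"

definition lie_deriv ::
  "('a::euclidean_space \<Rightarrow> 'a) \<Rightarrow> ('a \<Rightarrow> 'b::euclidean_space) \<Rightarrow> 'a \<Rightarrow> 'b" where
  "lie_deriv f g x = Lim (at 0) (\<lambda>t. (1 / t) *\<^sub>R (g (flow f t x) - g x))"

text \<open>\<open>hder f [j\<^sub>1, \<dots>, j\<^sub>k] g\<close> is \<open>X\<^sup>\<sharp>\<close> for \<open>j\<^sub>1\<close>, applied to \dots, applied to
  \<open>X\<^sup>\<sharp>\<close> for \<open>j\<^sub>k\<close>, applied to \<open>g\<close>.\<close>

primrec hder ::
  "(nat \<Rightarrow> 'a::euclidean_space \<Rightarrow> 'a) \<Rightarrow> nat list \<Rightarrow> ('a \<Rightarrow> 'b::euclidean_space) \<Rightarrow> 'a \<Rightarrow> 'b" where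
  "hder f [] g = g"
| "hder f (j # w) g = lie_deriv (f j) (hder f w g)"

primrec hder_exists ::
  "(nat \<Rightarrow> 'a::euclidean_space \<Rightarrow> 'a) \<Rightarrow> nat list \<Rightarrow> ('a \<Rightarrow> 'b::euclidean_space) \<Rightarrow> bool" where
  "hder_exists f [] g \<longleftrightarrow> True"
| "hder_exists f (j # w) g \<longleftrightarrow>
     hder_exists f w g \<and> (\<forall>x. \<exists>l. has_lie_deriv (f j) (hder f w g) x l)"

subsection \<open>Control distance and horizontal regularity\<close>

text \<open>\<open>reaches f r [(t\<^sub>1, j\<^sub>1), \<dots>, (t\<^sub>\<mu>, j\<^sub>\<mu>)] x y\<close> means
  \<open>y = e\<^bsup>t\<^sub>1Z\<^sub>1\<^esup> \<cdots> e\<^bsup>t\<^sub>\<mu>Z\<^sub>\<mu>\<^esup> x\<close> with \<open>Z\<^sub>i\<close> the field number \<open>j\<^sub>i\<close> times \<open>r\<close>;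
  the last entry of the list acts first.\<close>

primrec reaches ::
  "(nat \<Rightarrow> 'a::euclidean_space \<Rightarrow> 'a) \<Rightarrow> real \<Rightarrow> (real \<times> nat) list \<Rightarrow> 'a \<Rightarrow> 'a \<Rightarrow> bool" where
  "reaches f r [] x y \<longleftrightarrow> y = x"
| "reaches f r (p # ps) x y \<longleftrightarrow>
     (\<exists>z. reaches f r ps x z \<and> flows_to (\<lambda>u. r *\<^sub>R f (snd p) u) (fst p) z y)"

definition cdist :: "nat \<Rightarrow> (nat \<Rightarrow> 'a::euclidean_space \<Rightarrow> 'a) \<Rightarrow> 'a \<Rightarrow> 'a \<Rightarrow> ennreal" where
  "cdist m f x y = Inf (ennreal ` {r. 0 < r \<and>
     (\<exists>ps. snd ` set ps \<subseteq> {1..m} \<and> (\<Sum>p\<leftarrow>ps. \<bar>fst p\<bar>) \<le> 1 \<and> reaches f r ps x y)})"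

definition d_lipschitz_on ::
  "nat \<Rightarrow> (nat \<Rightarrow> 'a::euclidean_space \<Rightarrow> 'a) \<Rightarrow> 'a set \<Rightarrow> ('a \<Rightarrow> 'b::euclidean_space) \<Rightarrow> bool" where
  "d_lipschitz_on m f A g \<longleftrightarrow>
     (SUP (x, y)\<in>{(x, y). x \<in> A \<and> y \<in> A \<and> x \<noteq> y}. ennreal (norm (g x - g y)) / cdist m f x y) < top"

definition words :: "nat \<Rightarrow> nat \<Rightarrow> nat list set" where
  "words m k = {w. length w = k \<and> set w \<subseteq> {1..m}}"

definition CH :: "nat \<Rightarrow> (nat \<Rightarrow> 'a::euclidean_space \<Rightarrow> 'a) \<Rightarrow> nat \<Rightarrow> ('a \<Rightarrow> 'b::euclidean_space) \<Rightarrow> bool" where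
  "CH m f k g \<longleftrightarrow> (\<forall>w\<in>words m k. hder_exists f w g \<and>
     (\<forall>A. bounded A \<longrightarrow> d_lipschitz_on m f A (hder f w g)))"

subsection \<open>Commutators\<close>

text \<open>Permutations of \<open>{1..l}\<close> are functions on \<open>nat\<close>; only their values on \<open>{1..l}\<close>
  enter. The value at length \<open>0\<close> is a dummy.\<close>

fun perm_coeff :: "nat \<Rightarrow> (nat \<Rightarrow> nat) \<Rightarrow> real" where
  "perm_coeff 0 \<tau> = 0"
| "perm_coeff (Suc 0) \<tau> = 1"
| "perm_coeff (Suc (Suc k)) \<tau> =
     (if \<tau> 1 = 1 then perm_coeff (Suc k) (\<lambda>i. \<tau> (i + 1) - 1)
      else if \<tau> (Suc (Suc k)) = 1 then - perm_coeff (Suc k) (\<lambda>i. \<tau> i - 1)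
      else 0)"

text \<open>The letter \<open>w\<^sub>i\<close> is \<open>w ! (i - 1)\<close>; the result is the word with letters
  \<open>\<sigma>\<^sub>1(w), \<dots>, \<sigma>\<^sub>l(w)\<close>.\<close>

definition perm_word :: "(nat \<Rightarrow> nat) \<Rightarrow> nat list \<Rightarrow> nat list" where
  "perm_word \<sigma> w = map (\<lambda>i. w ! (\<sigma> i - 1)) [1..<Suc (length w)]"

definition comm_coeff :: "(nat \<Rightarrow> 'a::euclidean_space \<Rightarrow> 'a) \<Rightarrow> nat list \<Rightarrow> 'a \<Rightarrow> 'a" where
  "comm_coeff f w x = (\<Sum>\<sigma> | \<sigma> permutes {1..length w}. perm_coeff (length w) \<sigma> *\<^sub>R
     hder f (butlast (perm_word \<sigma> w)) (f (last (perm_word \<sigma> w))) x)"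

definition Xw :: "(nat \<Rightarrow> 'a::euclidean_space \<Rightarrow> 'a) \<Rightarrow> nat list \<Rightarrow> ('a \<Rightarrow> 'b::euclidean_space) \<Rightarrow> 'a \<Rightarrow> 'b" where
  "Xw f w \<psi> = vf_apply (comm_coeff f w) \<psi>"

definition Xw_sharp :: "(nat \<Rightarrow> 'a::euclidean_space \<Rightarrow> 'a) \<Rightarrow> nat list \<Rightarrow> ('a \<Rightarrow> 'b::euclidean_space) \<Rightarrow> 'a \<Rightarrow> 'b" where
  "Xw_sharp f w \<psi> x = (\<Sum>\<sigma> | \<sigma> permutes {1..length w}. perm_coeff (length w) \<sigma> *\<^sub>R
     hder f (perm_word \<sigma> w) \<psi> x)"

text \<open>Coefficients of \<open>ad\<^sub>Z X\<^sub>w\<close> and \<open>[Z, X\<^sub>w]\<close> for \<open>Z = \<psi> \<cdot> \<nabla>\<close>. The coefficients of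
  \<open>X\<^sub>w\<close> need not be differentiable along an arbitrary \<open>Z\<close>; at a point where they are
  not, \<open>lie_deriv\<close> is an unspecified vector, the same one in both definitions.\<close>

definition ad_coeff :: "(nat \<Rightarrow> 'a::euclidean_space \<Rightarrow> 'a) \<Rightarrow> ('a \<Rightarrow> 'a) \<Rightarrow> nat list \<Rightarrow> 'a \<Rightarrow> 'a" where
  "ad_coeff f \<psi> w x = lie_deriv \<psi> (comm_coeff f w) x - Xw f w \<psi> x"

definition bracket_coeff :: "(nat \<Rightarrow> 'a::euclidean_space \<Rightarrow> 'a) \<Rightarrow> ('a \<Rightarrow> 'a) \<Rightarrow> nat list \<Rightarrow> 'a \<Rightarrow> 'a" where
  "bracket_coeff f \<psi> w x = lie_deriv \<psi> (comm_coeff f w) x - Xw_sharp f w \<psi> x"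

end

theory Submission
  imports Defs
begin

text \<open>For a word \<open>w\<close> of length \<open>\<ell>\<close>, compose the flows \<open>e\<^bsup>\<plusminus>tX\<^sub>j\<^esup>\<close> as an iterated group
  commutator \<open>\<Phi>\<^sub>t\<close>. A function \<open>g\<close> of class \<open>C\<^sup>K\<^sup>,\<^sup>1\<close> along the horizontal fields has a
  noncommutative Taylor expansion of order \<open>K\<close> along such a composition, whose coefficients are those
  of the corresponding product of exponential series; for \<open>\<Phi>\<^sub>t\<close> this gives
  \<open>g (\<Phi>\<^sub>t x) = g x + t\<^sup>\<ell> X\<^sub>w\<^sup>\<sharp>g(x) + o(t\<^sup>\<ell>)\<close>. With \<open>g = id\<close> one finds
  \<open>\<Phi>\<^sub>t x = x + t\<^sup>\<ell> f\<^sub>w(x) + o(t\<^sup>\<ell>)\<close>, and if \<open>\<psi>\<close> is differentiable at \<open>x\<close>, the expansion of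
  \<open>\<psi> (\<Phi>\<^sub>t x)\<close> must therefore be \<open>\<psi> x + t\<^sup>\<ell> X\<^sub>w\<psi>(x) + o(t\<^sup>\<ell>)\<close> as well. This yields (i) for vector valued
  \<open>\<psi>\<close>, and (ii) follows because \<open>ad\<^sub>Z X\<^sub>w\<close> and \<open>[Z, X\<^sub>w]\<close> then have equal coefficients.\<close>

subsection \<open>Integral curves of \<open>C\<^sup>1\<close> fields\<close>

text \<open>Mean value inequality. The interval symmetric about 0 lets one statement serve both
  signs of \<open>t\<close>.\<close>

lemma vector_derivative_bound:
  fixes p :: "real \<Rightarrow> 'b::real_normed_vector"
  assumes der: "\<And>u. \<bar>u\<bar> \<le> \<bar>t\<bar> \<Longrightarrow> (p has_vector_derivative p' u) (at u within {-\<bar>t\<bar>..\<bar>t\<bar>})"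
    and bnd: "\<And>u. \<bar>u\<bar> \<le> \<bar>t\<bar> \<Longrightarrow> norm (p' u) \<le> B"
  shows "norm (p t - p 0) \<le> B * \<bar>t\<bar>"
proof -
  have "norm (p t - p 0) \<le> B * norm (t - 0)"
  proof (rule differentiable_bound[where S = "{-\<bar>t\<bar>..\<bar>t\<bar>}" and f' = "\<lambda>u h. h *\<^sub>R p' u"])
    show "(p has_derivative (\<lambda>h. h *\<^sub>R p' u)) (at u within {-\<bar>t\<bar>..\<bar>t\<bar>})" if "u \<in> {-\<bar>t\<bar>..\<bar>t\<bar>}" for u
      using der[of u] that by (auto simp: has_vector_derivative_def)
    show "onorm (\<lambda>h. h *\<^sub>R p' u) \<le> B" if "u \<in> {-\<bar>t\<bar>..\<bar>t\<bar>}" for u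
    proof (rule onorm_le)
      fix h :: real
      show "norm (h *\<^sub>R p' u) \<le> B * norm h"
        using mult_right_mono[OF bnd[of u], of "\<bar>h\<bar>"] that by (auto simp: mult.commute)
    qed
  qed auto
  then show ?thesis by simp
qed

text \<open>Banach's fixed point theorem for the Picard map \<open>J\<close>. For a bounded,
  globally Lipschitz field the time \<open>\<delta>\<close> is restricted by \<open>M\<close> alone
  and not by the starting point.\<close>

lemma picard_curve:
  fixes F :: "'a::euclidean_space \<Rightarrow> 'a"
  assumes lip: "\<And>x y. dist (F x) (F y) \<le> M * dist x y"
    and bnd: "\<And>x. norm (F x) \<le> N"
    and M: "0 < \<delta>" "M * \<delta> \<le> 1/2" "0 \<le> M"
  obtains \<gamma> where "\<gamma> 0 = x" "\<And>t. \<bar>t\<bar> < \<delta> \<Longrightarrow> (\<gamma> has_vector_derivative F (\<gamma> t)) (at t)"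
    "\<And>t. \<bar>t\<bar> < \<delta> \<Longrightarrow> norm (\<gamma> t - x) \<le> N * \<bar>t\<bar>"
proof -
  have contF: "continuous_on S F" for S
    by (rule lipschitz_on_continuous_on[of M]) (use lip M in \<open>auto simp: lipschitz_on_def\<close>)
  \<comment> \<open>Subtracting the integral up to 0 anchors the primitive at 0 and avoids integrals
    over reversed intervals for negative times.\<close>
  define J where "J \<gamma> t = x + integral {-\<delta>..t} (\<lambda>u. F (\<gamma> u)) - integral {-\<delta>..0} (\<lambda>u. F (\<gamma> u))"
    for \<gamma> :: "real \<Rightarrow> 'a" and t
  have J0: "J \<gamma> 0 = x" for \<gamma>
    by (simp add: J_def)
  have Jd: "(J \<gamma> has_vector_derivative F (\<gamma> t)) (at t within {-\<delta>..\<delta>})"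
    if "continuous_on UNIV \<gamma>" "\<bar>t\<bar> \<le> \<delta>" for \<gamma> t
  proof -
    have "continuous_on {-\<delta>..\<delta>} (\<lambda>u. F (\<gamma> u))"
      using continuous_on_compose2[OF contF[of UNIV] that(1)] continuous_on_subset by blast
    then have "((\<lambda>t. integral {-\<delta>..t} (\<lambda>u. F (\<gamma> u))) has_vector_derivative F (\<gamma> t)) (at t within {-\<delta>..\<delta>})"
      using integral_has_vector_derivative[of "-\<delta>" \<delta> "\<lambda>u. F (\<gamma> u)" t] that(2) by (simp add: abs_le_iff)
    then show ?thesis
      unfolding J_def by (auto intro!: derivative_eq_intros)
  qed
  have Jd': "(J \<gamma> has_vector_derivative F (\<gamma> u)) (at u within {-\<bar>t\<bar>..\<bar>t\<bar>})"
    if "continuous_on UNIV \<gamma>" "\<bar>t\<bar> \<le> \<delta>" "\<bar>u\<bar> \<le> \<bar>t\<bar>" for \<gamma> t u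
    by (rule has_vector_derivative_within_subset[OF Jd]) (use that in auto)
  \<comment> \<open>Freezing time outside \<open>{-\<delta>..\<delta>}\<close> turns the iterates
    into bounded continuous functions on the whole line, a complete space.\<close>
  define cl where "cl t = max (-\<delta>) (min \<delta> t)" for t
  have cl: "\<bar>cl t\<bar> \<le> \<delta>" "\<bar>t\<bar> \<le> \<delta> \<Longrightarrow> cl t = t" for t
    using M by (auto simp: cl_def)
  have Jb: "norm (J \<gamma> t - x) \<le> N * \<bar>t\<bar>" if "continuous_on UNIV \<gamma>" "\<bar>t\<bar> \<le> \<delta>" for \<gamma> t
    using vector_derivative_bound[of t "J \<gamma>" "\<lambda>u. F (\<gamma> u)" N] Jd'[OF that] bnd by (simp add: J0)
  have N0: "0 \<le> N"
    using bnd[of 0] norm_ge_zero order_trans by blast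
  have bc: "(\<lambda>t. J \<gamma> (cl t)) \<in> bcontfun" if "continuous_on UNIV \<gamma>" for \<gamma>
  proof (rule bcontfun_normI)
    have "continuous_on {-\<delta>..\<delta>} (J \<gamma>)"
      by (rule continuous_on_vector_derivative[where f' = "\<lambda>u. F (\<gamma> u)"]) (rule Jd[OF that], auto)
    moreover have "continuous_on UNIV cl"
      unfolding cl_def by (intro continuous_intros)
    ultimately show "continuous_on UNIV (\<lambda>t. J \<gamma> (cl t))"
      by (rule continuous_on_compose2) (use cl(1) in \<open>auto simp: abs_le_iff minus_le_iff\<close>)
    fix t
    have "norm (J \<gamma> (cl t)) \<le> norm x + norm (J \<gamma> (cl t) - x)"
      by (rule norm_triangle_sub)
    also have "\<dots> \<le> norm x + N * \<delta>"
      using Jb[OF that, of "cl t"] cl(1)[of t] mult_left_mono[OF cl(1)[of t] N0] by linarith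
    finally show "norm (J \<gamma> (cl t)) \<le> norm x + N * \<delta>" .
  qed
  define T where "T \<gamma> = Bcontfun (\<lambda>t. J (apply_bcontfun \<gamma>) (cl t))" for \<gamma>
  have T: "apply_bcontfun (T \<gamma>) t = J (apply_bcontfun \<gamma>) (cl t)" for \<gamma> t
    unfolding T_def by (subst Bcontfun_inverse) (auto intro!: bc)
  have "dist (T \<gamma>) (T \<eta>) \<le> 1/2 * dist \<gamma> \<eta>" for \<gamma> \<eta>
  proof (rule dist_bound)
    fix t
    let ?t = "cl t"
    \<comment> \<open>\<open>J\<close> takes the value \<open>x\<close> at 0 for every curve, so the
      difference of two images is controlled by its derivative alone.\<close>
    have "norm ((J \<gamma> ?t - J \<eta> ?t) - (J \<gamma> 0 - J \<eta> 0)) \<le> (M * dist \<gamma> \<eta>) * \<bar>?t\<bar>"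
    proof (rule vector_derivative_bound)
      fix u assume u: "\<bar>u\<bar> \<le> \<bar>?t\<bar>"
      show "((\<lambda>u. J \<gamma> u - J \<eta> u) has_vector_derivative F (\<gamma> u) - F (\<eta> u)) (at u within {-\<bar>?t\<bar>..\<bar>?t\<bar>})"
        by (intro has_vector_derivative_diff Jd' u cl) auto
      show "norm (F (\<gamma> u) - F (\<eta> u)) \<le> M * dist \<gamma> \<eta>"
        using lip[of "\<gamma> u" "\<eta> u"] mult_left_mono[OF dist_bounded[of \<gamma> u \<eta>] M(3)]
        by (simp add: dist_norm)
    qed
    also have "\<dots> \<le> (M * dist \<gamma> \<eta>) * \<delta>"
      by (intro mult_left_mono cl) (use M in auto)
    also have "\<dots> \<le> 1/2 * dist \<gamma> \<eta>"
      using mult_right_mono[OF M(2), of "dist \<gamma> \<eta>"] by (simp add: mult_ac)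
    finally show "dist (T \<gamma> t) (T \<eta> t) \<le> 1/2 * dist \<gamma> \<eta>"
      by (simp add: T dist_norm J0)
  qed
  then obtain \<gamma> where g: "T \<gamma> = \<gamma>"
    using banach_fix_type[of "1/2" T] by auto
  have eq: "\<gamma> t = J \<gamma> t" if "\<bar>t\<bar> \<le> \<delta>" for t
    using T[of \<gamma> t] cl(2)[OF that] g by simp
  have "(\<gamma> has_vector_derivative F (\<gamma> t)) (at t)" if t: "\<bar>t\<bar> < \<delta>" for t
  proof -
    have "(J \<gamma> has_vector_derivative F (\<gamma> t)) (at t within {-\<delta><..<\<delta>})"
      by (rule has_vector_derivative_within_subset[OF Jd]) (use t in auto)
    then have "(J \<gamma> has_vector_derivative F (\<gamma> t)) (at t)"
      by (subst (asm) has_vector_derivative_within_open) (use t in auto)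
    then show ?thesis
      by (rule has_vector_derivative_transform_within_open[where S = "{-\<delta><..<\<delta>}"]) (use t eq in auto)
  qed
  moreover have "norm (\<gamma> t - x) \<le> N * \<bar>t\<bar>" if "\<bar>t\<bar> < \<delta>" for t
    using Jb[of \<gamma> t] eq[of t] that by auto
  moreover have "\<gamma> 0 = x" using eq[of 0] J0 M by simp
  ultimately show ?thesis using that by blast
qed

lemma C1_lipschitz_on_cball:
  fixes f :: "'a::euclidean_space \<Rightarrow> 'b::euclidean_space"
  assumes "C1 f"
  obtains M where "0 \<le> M" "\<And>x y. x \<in> cball 0 R \<Longrightarrow> y \<in> cball 0 R \<Longrightarrow> norm (f x - f y) \<le> M * norm (x - y)"
proof -
  obtain f' where f': "\<And>x. (f has_derivative blinfun_apply (f' x)) (at x)" "continuous_on UNIV f'"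
    using assms by (auto simp: C1_def)
  have "compact (f' ` cball 0 R)"
    by (intro compact_continuous_image continuous_on_subset[OF f'(2)]) auto
  then obtain M where M: "\<And>x. x \<in> cball 0 R \<Longrightarrow> norm (f' x) \<le> M" "0 < M"
    by (metis bounded_pos compact_imp_bounded image_eqI)
  show ?thesis
  proof (rule that[of M])
    fix x y :: 'a assume "x \<in> cball 0 R" "y \<in> cball 0 R"
    then show "norm (f x - f y) \<le> M * norm (x - y)"
    proof (intro differentiable_bound[where S = "cball 0 R" and f' = "\<lambda>x. blinfun_apply (f' x)"])
      show "(f has_derivative blinfun_apply (f' z)) (at z within cball 0 R)" for z
        by (rule has_derivative_at_withinI) (rule f'(1))
      show "onorm (blinfun_apply (f' z)) \<le> M" if "z \<in> cball 0 R" for z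
        using M(1)[OF that] by (simp add: norm_blinfun.rep_eq)
    qed auto
  qed (use M in auto)
qed

text \<open>\<open>f\<close> is Lipschitz only locally, so it is composed with the projection onto
  the ball of radius \<open>R + 1\<close>. The curves of the resulting field \<open>F\<close> stay
  in that ball for a time uniform in the starting point, and there \<open>F\<close> agrees with
  \<open>f\<close>.\<close>

lemma integral_curve_exists:
  fixes f :: "'a::euclidean_space \<Rightarrow> 'a"
  assumes "C1 f"
  shows "\<exists>\<delta>>0. \<forall>x\<in>cball 0 R. \<exists>\<gamma>. \<gamma> 0 = x \<and>
    (\<forall>t. \<bar>t\<bar> < \<delta> \<longrightarrow> (\<gamma> has_vector_derivative f (\<gamma> t)) (at t) \<and> \<gamma> t \<in> cball 0 (R + 1))"
proof (cases "R \<ge> 0")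
  case False
  then have "x \<notin> cball 0 R" for x :: 'a
    using norm_ge_zero[of x] by (simp add: not_le)
  then show ?thesis by (intro exI[of _ "1::real"]) auto
next
  case True
  let ?B = "cball (0::'a) (R + 1)"
  obtain M where M: "0 \<le> M" "\<And>x y. x \<in> ?B \<Longrightarrow> y \<in> ?B \<Longrightarrow> norm (f x - f y) \<le> M * norm (x - y)"
    using C1_lipschitz_on_cball[OF assms, of "R + 1"] by blast
  define F where "F x = f (closest_point ?B x)" for x
  have cp: "closest_point ?B x \<in> ?B" for x
    by (rule closest_point_in_set) (use True in auto)
  define N where "N = norm (f 0) + M * (R + 1)"
  have bnd: "norm (F x) \<le> N" for x
  proof -
    let ?y = "closest_point ?B x"
    have "norm (f ?y) \<le> norm (f 0) + norm (f ?y - f 0)"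
      by (rule norm_triangle_sub)
    also have "norm (f ?y - f 0) \<le> M * norm (?y - 0)"
      by (rule M(2)) (use cp True in auto)
    also have "\<dots> \<le> M * (R + 1)"
      by (rule mult_left_mono) (use cp[of x] M in auto)
    finally show ?thesis by (simp add: F_def N_def)
  qed
  have N0: "0 \<le> N" using bnd[of 0] norm_ge_zero order_trans by blast
  have lip: "dist (F x) (F y) \<le> M * dist x y" for x y
  proof -
    have "dist (F x) (F y) \<le> M * dist (closest_point ?B x) (closest_point ?B y)"
      using M(2)[OF cp cp] by (simp add: F_def dist_norm)
    also have "\<dots> \<le> M * dist x y"
      by (intro mult_left_mono closest_point_lipschitz M) (use True in auto)
    finally show ?thesis .
  qed
  \<comment> \<open>The first bound makes the Picard map contract by 1/2; the second limits the
    displacement to 1.\<close>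
  define \<delta> where "\<delta> = min (1 / (2 * (M + 1))) (1 / (N + 1))"
  have d: "0 < \<delta>" using M N0 by (simp add: \<delta>_def)
  have Md: "M * \<delta> \<le> 1/2"
  proof -
    have "M * \<delta> \<le> M * (1 / (2 * (M + 1)))"
      by (rule mult_left_mono) (use M in \<open>auto simp: \<delta>_def\<close>)
    also have "\<dots> \<le> 1/2" using M by (simp add: divide_simps)
    finally show ?thesis .
  qed
  have Nd: "N * \<delta> \<le> 1"
  proof -
    have "N * \<delta> \<le> N * (1 / (N + 1))"
      by (rule mult_left_mono) (use N0 in \<open>auto simp: \<delta>_def\<close>)
    also have "\<dots> \<le> 1" using N0 by (simp add: divide_simps)
    finally show ?thesis .
  qed
  show ?thesis
  proof (rule exI[of _ \<delta>], intro conjI d ballI)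
    fix x :: 'a assume x: "x \<in> cball 0 R"
    obtain \<gamma> where g: "\<gamma> 0 = x" "\<And>t. \<bar>t\<bar> < \<delta> \<Longrightarrow> (\<gamma> has_vector_derivative F (\<gamma> t)) (at t)"
      "\<And>t. \<bar>t\<bar> < \<delta> \<Longrightarrow> norm (\<gamma> t - x) \<le> N * \<bar>t\<bar>"
      using picard_curve[OF lip bnd d Md M(1)] by blast
    have b: "\<gamma> t \<in> ?B" if t: "\<bar>t\<bar> < \<delta>" for t
    proof -
      have "norm (\<gamma> t) \<le> norm x + norm (\<gamma> t - x)" by (rule norm_triangle_sub)
      also have "\<dots> \<le> R + N * \<delta>"
        using x g(3)[OF t] mult_left_mono[of "\<bar>t\<bar>" \<delta> N] t N0 by auto
      finally show ?thesis using Nd by simp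
    qed
    have "F (\<gamma> t) = f (\<gamma> t)" if "\<bar>t\<bar> < \<delta>" for t
      using b[OF that] by (simp only: F_def closest_point_self)
    then show "\<exists>\<gamma>. \<gamma> 0 = x \<and>
      (\<forall>t. \<bar>t\<bar> < \<delta> \<longrightarrow> (\<gamma> has_vector_derivative f (\<gamma> t)) (at t) \<and> \<gamma> t \<in> ?B)"
      using g b by metis
  qed
qed

text \<open>Gronwall: \<open>exp (- 2 K t) \<cdot> |\<gamma> t - \<eta> t|\<^sup>2\<close> is nonincreasing.\<close>

lemma integral_curve_unique_pos:
  fixes f :: "'a::euclidean_space \<Rightarrow> 'a"
  assumes "C1 f" and T: "0 \<le> T" and "\<gamma> 0 = \<eta> 0"
    and g: "\<And>u. u \<in> {0..T} \<Longrightarrow> (\<gamma> has_vector_derivative f (\<gamma> u)) (at u within {0..T})"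
    and e: "\<And>u. u \<in> {0..T} \<Longrightarrow> (\<eta> has_vector_derivative f (\<eta> u)) (at u within {0..T})"
  shows "\<gamma> T = \<eta> T"
proof -
  have cont: "continuous_on {0..T} \<gamma>" "continuous_on {0..T} \<eta>"
    by (rule continuous_on_vector_derivative, rule g e, assumption)+
  then have "bounded (\<gamma> ` {0..T} \<union> \<eta> ` {0..T})"
    by (intro bounded_Un[THEN iffD2] conjI compact_imp_bounded compact_continuous_image) auto
  then obtain R where R: "\<And>u. u \<in> {0..T} \<Longrightarrow> \<gamma> u \<in> cball 0 R \<and> \<eta> u \<in> cball 0 R"
    unfolding bounded_iff mem_cball_0 by blast
  obtain K where K: "0 \<le> K" "\<And>x y. x \<in> cball 0 R \<Longrightarrow> y \<in> cball 0 R \<Longrightarrow> norm (f x - f y) \<le> K * norm (x - y)"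
    using C1_lipschitz_on_cball[OF assms(1)] by blast
  let ?z = "\<lambda>u. \<gamma> u - \<eta> u"
  let ?q = "\<lambda>u. exp (-2 * K * u) * (?z u \<bullet> ?z u)"
  let ?q' = "\<lambda>u. exp (-2 * K * u) * (2 * ((f (\<gamma> u) - f (\<eta> u)) \<bullet> ?z u)) - 2 * K * exp (-2 * K * u) * (?z u \<bullet> ?z u)"
  have "?q T \<le> ?q 0"
  proof (rule DERIV_nonpos_imp_decreasing_open[where f = ?q])
    show "0 \<le> T" by fact
    show "continuous_on {0..T} ?q" by (intro continuous_intros cont)
    fix u assume u: "0 < u" "u < T"
    then have at: "at u within {0..T} = at u"
      by (intro at_within_interior) auto
    have z: "(?z has_derivative (\<lambda>h. h *\<^sub>R (f (\<gamma> u) - f (\<eta> u)))) (at u)"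
      using has_vector_derivative_diff[OF g[of u] e[of u]] u by (auto simp: at has_vector_derivative_def)
    have "((\<lambda>u. ?z u \<bullet> ?z u) has_field_derivative 2 * ((f (\<gamma> u) - f (\<eta> u)) \<bullet> ?z u)) (at u)"
      unfolding has_field_derivative_def
      by (rule has_derivative_eq_rhs[OF has_derivative_inner[OF z z]]) (simp add: fun_eq_iff inner_commute)
    then have "(?q has_field_derivative ?q' u) (at u)"
      by (rule DERIV_cong[OF DERIV_mult[rotated]]) (auto intro!: derivative_eq_intros)
    moreover have "?q' u \<le> 0"
    proof -
      have "(f (\<gamma> u) - f (\<eta> u)) \<bullet> ?z u \<le> norm (f (\<gamma> u) - f (\<eta> u)) * norm (?z u)"
        by (rule norm_cauchy_schwarz)
      also have "\<dots> \<le> K * norm (?z u) * norm (?z u)"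
        by (rule mult_right_mono) (use K(2) R[of u] u in auto)
      also have "\<dots> = K * (?z u \<bullet> ?z u)"
        by (simp add: power2_norm_eq_inner[symmetric] power2_eq_square)
      finally have "exp (-2 * K * u) * (2 * ((f (\<gamma> u) - f (\<eta> u)) \<bullet> ?z u)) \<le> exp (-2 * K * u) * (2 * (K * (?z u \<bullet> ?z u)))"
        by simp
      then show ?thesis by (simp only: mult_ac)
    qed
    ultimately show "\<exists>y. (?q has_field_derivative y) (at u) \<and> y \<le> 0" by blast
  qed
  then have "?z T \<bullet> ?z T \<le> 0"
    using assms(3) by (simp add: mult_le_0_iff)
  then show ?thesis by (metis inner_gt_zero_iff not_le right_minus_eq)
qed

subsection \<open>Lie derivatives along flows\<close>

lemma C1_uminus: "C1 f \<Longrightarrow> C1 (\<lambda>x. - f x)"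
proof -
  assume "C1 f"
  then obtain f' where f': "\<And>x. (f has_derivative blinfun_apply (f' x)) (at x)" "continuous_on UNIV f'"
    by (auto simp: C1_def)
  have "((\<lambda>x. - f x) has_derivative blinfun_apply (- f' x)) (at x)" for x
    using has_derivative_minus[OF f'(1)] by (simp add: uminus_blinfun.rep_eq)
  moreover have "continuous_on UNIV (\<lambda>x. - f' x)"
    using f'(2) by (rule continuous_on_minus)
  ultimately show ?thesis
    unfolding C1_def by (intro exI[of _ "\<lambda>x. - f' x"]) auto
qed

lemma flows_to_unique:
  assumes "C1 f" "flows_to f t x y" "flows_to f t x z"
  shows "y = z"
proof -
  obtain \<gamma> where g0: "\<gamma> 0 = x" "\<gamma> t = y"
    and g: "\<forall>u\<in>closed_segment 0 t. (\<gamma> has_vector_derivative f (\<gamma> u)) (at u within closed_segment 0 t)"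
    using assms(2) unfolding flows_to_def by blast
  obtain \<eta> where e0: "\<eta> 0 = x" "\<eta> t = z"
    and e: "\<forall>u\<in>closed_segment 0 t. (\<eta> has_vector_derivative f (\<eta> u)) (at u within closed_segment 0 t)"
    using assms(3) unfolding flows_to_def by blast
  show ?thesis
  proof (cases "0 \<le> t")
    case True
    then have seg: "closed_segment 0 t = {0..t}" by (simp add: closed_segment_eq_real_ivl)
    have "\<gamma> t = \<eta> t"
      by (rule integral_curve_unique_pos[OF assms(1) True _ g[unfolded seg, rule_format] e[unfolded seg, rule_format]])
         (simp_all add: g0 e0)
    then show ?thesis by (simp add: g0 e0)
  next
    case False
    then have seg: "closed_segment 0 t = {t..0}" by (simp add: closed_segment_eq_real_ivl)
    \<comment> \<open>Time reversal produces an integral curve of \<open>-f\<close> and so reduces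
      negative times to uniqueness for positive ones.\<close>
    have rev: "((\<lambda>u. \<zeta> (- u)) has_vector_derivative - f (\<zeta> (- u))) (at u within {0..-t})"
      if z: "\<forall>u\<in>{t..0}. (\<zeta> has_vector_derivative f (\<zeta> u)) (at u within {t..0})"
        and u: "u \<in> {0..-t}" for \<zeta> u
    proof -
      have "uminus ` {0..-t} = {t..0}" by simp
      then have "(\<zeta> has_vector_derivative f (\<zeta> (- u))) (at (- u) within uminus ` {0..-t})"
        using z u by auto
      moreover have "(uminus has_vector_derivative - 1) (at u within {0..-t})"
        by (auto intro!: derivative_eq_intros)
      ultimately show ?thesis
        using vector_diff_chain_within[of uminus "-1" u "{0..-t}" \<zeta> "f (\<zeta> (- u))"]
        by (simp add: o_def)
    qed
    have "(\<lambda>u. \<gamma> (- u)) (- t) = (\<lambda>u. \<eta> (- u)) (- t)"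
      by (rule integral_curve_unique_pos[OF C1_uminus[OF assms(1)] _ _
            rev[OF g[unfolded seg]] rev[OF e[unfolded seg]]])
         (use False in \<open>simp_all add: g0 e0\<close>)
    then show ?thesis by (simp add: g0 e0)
  qed
qed

lemma flow_eqI: "C1 f \<Longrightarrow> flows_to f t x y \<Longrightarrow> flow f t x = y"
  unfolding flow_def using flows_to_unique by blast

lemma flows_to_along_curve:
  assumes \<gamma>: "\<And>u. \<bar>u\<bar> < \<delta> \<Longrightarrow> (\<gamma> has_vector_derivative f (\<gamma> u)) (at u)"
    and t: "\<bar>t\<bar> < \<delta>" "\<bar>t + h\<bar> < \<delta>"
  shows "flows_to f h (\<gamma> t) (\<gamma> (t + h))"
  unfolding flows_to_def
proof (intro exI[of _ "\<lambda>u. \<gamma> (t + u)"] conjI ballI)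
  fix u assume "u \<in> closed_segment 0 h"
  then have "\<bar>t + u\<bar> < \<delta>" using t by (auto simp: closed_segment_eq_real_ivl split: if_splits)
  moreover have "((+) t has_vector_derivative 1) (at u)"
    by (auto intro!: derivative_eq_intros)
  ultimately have "((\<lambda>u. \<gamma> (t + u)) has_vector_derivative f (\<gamma> (t + u))) (at u)"
    using vector_diff_chain_at[of "(+) t" 1 u \<gamma> "f (\<gamma> (t + u))"] \<gamma>[of "t + u"] by (simp add: o_def)
  then show "((\<lambda>u. \<gamma> (t + u)) has_vector_derivative f (\<gamma> (t + u))) (at u within closed_segment 0 h)"
    by (rule has_vector_derivative_at_within)
qed auto

lemma has_lie_deriv_imp_lie_deriv: "has_lie_deriv f g x l \<Longrightarrow> lie_deriv f g x = l"
  unfolding has_lie_deriv_def lie_deriv_def by (rule tendsto_Lim) auto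

lemma has_vector_derivative_iff_quotient:
  "(p has_vector_derivative l) (at t) \<longleftrightarrow> ((\<lambda>h. (1 / h) *\<^sub>R (p (t + h) - p t)) \<longlongrightarrow> l) (at 0)"
proof -
  have "norm (p (t + h) - p t - h *\<^sub>R l) / norm h = norm ((1 / h) *\<^sub>R (p (t + h) - p t) - l)"
    if "h \<noteq> 0" for h
  proof -
    have "(1 / h) *\<^sub>R (p (t + h) - p t) - l = (1 / h) *\<^sub>R (p (t + h) - p t - h *\<^sub>R l)"
      using that by (simp add: algebra_simps)
    then show ?thesis by simp
  qed
  then have "((\<lambda>h. norm (p (t + h) - p t - h *\<^sub>R l) / norm h) \<longlongrightarrow> 0) (at 0) \<longleftrightarrow>
      ((\<lambda>h. norm ((1 / h) *\<^sub>R (p (t + h) - p t) - l)) \<longlongrightarrow> 0) (at 0)"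
    by (intro tendsto_cong) (auto simp: eventually_at_filter)
  also have "\<dots> \<longleftrightarrow> ((\<lambda>h. (1 / h) *\<^sub>R (p (t + h) - p t)) \<longlongrightarrow> l) (at 0)"
    by (simp only: tendsto_norm_zero_iff LIM_zero_iff)
  finally show ?thesis
    by (simp add: has_vector_derivative_def has_derivative_at bounded_linear_scaleR_left)
qed

text \<open>For short times the flow just follows \<open>\<gamma>\<close>. Statements about Lie
  derivatives thus become calculus for a function of one real variable.\<close>

lemma has_lie_deriv_along_curve:
  assumes "C1 f" and \<gamma>: "\<And>u. \<bar>u\<bar> < \<delta> \<Longrightarrow> (\<gamma> has_vector_derivative f (\<gamma> u)) (at u)"
    and t: "\<bar>t\<bar> < \<delta>"
  shows "has_lie_deriv f g (\<gamma> t) l \<longleftrightarrow> ((\<lambda>u. g (\<gamma> u)) has_vector_derivative l) (at t)"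
  unfolding has_lie_deriv_def has_vector_derivative_iff_quotient
proof (rule tendsto_cong)
  have "\<forall>\<^sub>F h in at 0. \<bar>t + h\<bar> < \<delta>"
    unfolding eventually_at by (rule exI[of _ "\<delta> - \<bar>t\<bar>"]) (use t in \<open>auto simp: dist_real_def\<close>)
  then show "\<forall>\<^sub>F h in at 0. (1 / h) *\<^sub>R (g (flow f h (\<gamma> t)) - g (\<gamma> t)) = (1 / h) *\<^sub>R (g (\<gamma> (t + h)) - g (\<gamma> t))"
  proof eventually_elim
    case (elim h)
    have "flow f h (\<gamma> t) = \<gamma> (t + h)"
      by (rule flow_eqI[OF assms(1)], rule flows_to_along_curve[OF \<gamma> t elim])
    then show ?case by simp
  qed
qed

text \<open>Presents the coefficients of a field as a Lie derivative of the identity, so that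
  commutator coefficients become combinations of horizontal derivatives of one function.\<close>

lemma has_lie_deriv_id:
  assumes "C1 f"
  shows "has_lie_deriv f (\<lambda>x. x) x (f x)"
proof -
  obtain \<delta> where \<delta>: "0 < \<delta>" "\<forall>z\<in>cball 0 (norm x). \<exists>\<gamma>. \<gamma> 0 = z \<and>
      (\<forall>t. \<bar>t\<bar> < \<delta> \<longrightarrow> (\<gamma> has_vector_derivative f (\<gamma> t)) (at t) \<and> \<gamma> t \<in> cball 0 (norm x + 1))"
    using integral_curve_exists[OF assms, of "norm x"] by blast
  have "x \<in> cball 0 (norm x)" by simp
  from \<delta>(2)[rule_format, OF this] obtain \<gamma> where \<gamma>: "\<gamma> 0 = x" "\<And>t. \<bar>t\<bar> < \<delta> \<Longrightarrow> (\<gamma> has_vector_derivative f (\<gamma> t)) (at t)"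
    by blast
  have "((\<lambda>u. \<gamma> u) has_vector_derivative f (\<gamma> 0)) (at 0)"
    by (rule \<gamma>(2)) (simp add: \<delta>(1))
  then have "has_lie_deriv f (\<lambda>x. x) (\<gamma> 0) (f (\<gamma> 0))"
    by (subst has_lie_deriv_along_curve[OF assms \<gamma>(2), of \<delta>]) (simp_all add: \<delta>(1))
  then show ?thesis by (simp only: \<gamma>(1))
qed

lemma lie_deriv_id: "C1 f \<Longrightarrow> lie_deriv f (\<lambda>x. x) = f"
  by (simp add: fun_eq_iff has_lie_deriv_imp_lie_deriv[OF has_lie_deriv_id])

section \<open>Words of horizontal derivatives and the control distance\<close>

lemma hder_append: "hder f (u @ v) g = hder f u (hder f v g)"
  by (induction u) auto

lemma hder_exists_append: "hder_exists f (u @ v) g \<longleftrightarrow> hder_exists f v g \<and> hder_exists f u (hder f v g)"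
  by (induction u) (auto simp: hder_append)

lemma CH_hder:
  assumes "CH m f K g" "set v \<subseteq> {1..m}" "length v \<le> K"
  shows "CH m f (K - length v) (hder f v g)"
  unfolding CH_def
proof (intro ballI)
  fix u assume "u \<in> words m (K - length v)"
  then have "u @ v \<in> words m K" using assms by (auto simp: words_def)
  then show "hder_exists f u (hder f v g) \<and> (\<forall>A. bounded A \<longrightarrow> d_lipschitz_on m f A (hder f u (hder f v g)))"
    using assms(1) by (auto simp: CH_def hder_append hder_exists_append)
qed

lemma cdist_le_flow_time:
  assumes "flows_to (f j) t x y" "j \<in> {1..m}" "t \<noteq> 0"
  shows "cdist m f x y \<le> ennreal \<bar>t\<bar>"
  unfolding cdist_def
\<comment> \<open>The witness is the radius \<open>\<bar>t\<bar>\<close> with a single leg of time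
  \<open>sgn t\<close>: the rescaled field runs through the same curve in unit time.\<close>
proof (rule Inf_lower, rule imageI, intro CollectI conjI exI[of _ "[(sgn t, j)]"])
  obtain \<gamma> where g: "\<gamma> 0 = x" "\<gamma> t = y"
    "\<forall>u\<in>closed_segment 0 t. (\<gamma> has_vector_derivative f j (\<gamma> u)) (at u within closed_segment 0 t)"
    using assms(1) unfolding flows_to_def by blast
  have img: "(*) \<bar>t\<bar> ` closed_segment 0 (sgn t) = closed_segment 0 t"
    using closed_segment_linear_image[of "(*) \<bar>t\<bar>" 0 "sgn t"]
    by (simp add: bounded_linear_mult_right bounded_linear.linear abs_mult_sgn)
  have "flows_to (\<lambda>u. \<bar>t\<bar> *\<^sub>R f j u) (sgn t) x y"
    unfolding flows_to_def
  proof (intro exI[of _ "\<lambda>u. \<gamma> (\<bar>t\<bar> * u)"] conjI ballI)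
    fix u assume "u \<in> closed_segment 0 (sgn t)"
    then have "(\<gamma> has_vector_derivative f j (\<gamma> (\<bar>t\<bar> * u))) (at (\<bar>t\<bar> * u) within (*) \<bar>t\<bar> ` closed_segment 0 (sgn t))"
      using g(3) unfolding img[symmetric] by blast
    moreover have "((*) \<bar>t\<bar> has_vector_derivative \<bar>t\<bar>) (at u within closed_segment 0 (sgn t))"
      by (auto intro!: derivative_eq_intros)
    ultimately show "((\<lambda>u. \<gamma> (\<bar>t\<bar> * u)) has_vector_derivative \<bar>t\<bar> *\<^sub>R f j (\<gamma> (\<bar>t\<bar> * u))) (at u within closed_segment 0 (sgn t))"
      using vector_diff_chain_within[of "(*) \<bar>t\<bar>" "\<bar>t\<bar>" u "closed_segment 0 (sgn t)" \<gamma>] by (simp add: o_def)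
  qed (use g in \<open>auto simp: abs_mult_sgn\<close>)
  then show "reaches f \<bar>t\<bar> [(sgn t, j)] x y" by simp
qed (use assms in \<open>auto simp: abs_sgn_eq\<close>)

lemma ennreal_inverse_antimono: "a \<le> b \<Longrightarrow> inverse b \<le> inverse (a :: ennreal)"
  by (simp add: less_eq_ennreal.rep_eq inverse_ennreal.rep_eq ereal_inverse_antimono)

text \<open>The form in which \<open>d\<close>-Lipschitz continuity enters. Flowing along one field
  for time \<open>t\<close> costs at most \<open>\<bar>t\<bar>\<close> in the control distance, so
  \<open>g\<close> is Lipschitz in time, uniformly on \<open>A\<close> and over the family.\<close>

lemma d_lipschitz_on_flow:
  assumes "d_lipschitz_on m f A g"
  obtains L where "0 \<le> L" "\<And>j t x y. flows_to (f j) t x y \<Longrightarrow> j \<in> {1..m} \<Longrightarrow> x \<in> A \<Longrightarrow> y \<in> A \<Longrightarrow>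
    norm (g y - g x) \<le> L * \<bar>t\<bar>"
proof -
  let ?S = "SUP (x, y)\<in>{(x, y). x \<in> A \<and> y \<in> A \<and> x \<noteq> y}. ennreal (norm (g x - g y)) / cdist m f x y"
  obtain L where L: "?S = ennreal L" "0 \<le> L"
    using assms unfolding d_lipschitz_on_def by (cases ?S) auto
  show ?thesis
  proof (rule that[OF L(2)])
    fix j t x y assume h: "flows_to (f j) t x y" "j \<in> {1..m}" "x \<in> A" "y \<in> A"
    show "norm (g y - g x) \<le> L * \<bar>t\<bar>"
    proof (cases "x = y")
      case False
      then have t: "t \<noteq> 0" using h(1) by (auto simp: flows_to_def)
      have "ennreal (norm (g x - g y)) / ennreal \<bar>t\<bar> \<le> ennreal (norm (g x - g y)) / cdist m f x y"
        unfolding divide_ennreal_def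
        by (intro mult_left_mono ennreal_inverse_antimono cdist_le_flow_time[of f j t x y m, OF h(1,2) t]) auto
      also have "\<dots> \<le> ennreal L"
        unfolding L(1)[symmetric] using h False by (intro SUP_upper2[of "(x, y)"]) auto
      finally have "norm (g x - g y) / \<bar>t\<bar> \<le> L"
        using t L by (simp add: divide_ennreal)
      then show ?thesis using t by (simp add: divide_simps norm_minus_commute)
    qed (use L in auto)
  qed
qed

section \<open>Taylor expansion along a single flow\<close>

text \<open>Induction on \<open>K\<close>: the remainder of order \<open>Suc K\<close> vanishes at
  0, and its derivative is the remainder of order \<open>K\<close> of the shifted sequence. The
  Lipschitz bound on \<open>h K\<close> stands in for one further derivative.\<close>

lemma taylor_lipschitz_remainder:
  fixes h :: "nat \<Rightarrow> real \<Rightarrow> 'b::real_normed_vector"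
  assumes "\<And>k t. k < K \<Longrightarrow> \<bar>t\<bar> < \<delta> \<Longrightarrow> (h k has_vector_derivative h (Suc k) t) (at t)"
    and "\<And>t. \<bar>t\<bar> < \<delta> \<Longrightarrow> norm (h K t - h K 0) \<le> L * \<bar>t\<bar>" and "0 \<le> L" and "\<bar>t\<bar> < \<delta>"
  shows "norm (h 0 t - (\<Sum>k\<le>K. (t ^ k / fact k) *\<^sub>R h k 0)) \<le> L * \<bar>t\<bar> ^ Suc K"
  using assms
proof (induction K arbitrary: h t)
  case (Suc K)
  let ?r = "\<lambda>t. h 0 t - (\<Sum>k\<le>Suc K. (t ^ k / fact k) *\<^sub>R h k 0)"
  let ?r' = "\<lambda>t. h 1 t - (\<Sum>k\<le>K. (t ^ k / fact k) *\<^sub>R h (Suc k) 0)"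
  have "norm (?r t - ?r 0) \<le> (L * \<bar>t\<bar> ^ Suc K) * \<bar>t\<bar>"
  proof (rule vector_derivative_bound)
    fix u assume u: "\<bar>u\<bar> \<le> \<bar>t\<bar>"
    then have u': "\<bar>u\<bar> < \<delta>" using Suc.prems by simp
    have d: "((\<lambda>t. (t ^ Suc k / fact (Suc k)) *\<^sub>R z) has_vector_derivative (u ^ k / fact k) *\<^sub>R z) (at u)" for k and z :: 'b
    proof -
      have "((\<lambda>t. t ^ Suc k / fact (Suc k)) has_field_derivative u ^ k / fact k) (at u)"
        by (rule DERIV_cong[OF DERIV_cdivide[OF DERIV_pow]]) (simp add: divide_simps)
      then show ?thesis
        by (rule has_vector_derivative_eq_rhs[OF has_vector_derivative_scaleR[OF _ has_vector_derivative_const]]) simp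
    qed
    have "((\<lambda>t. h 0 t - (h 0 0 + (\<Sum>k\<le>K. (t ^ Suc k / fact (Suc k)) *\<^sub>R h (Suc k) 0))) has_vector_derivative ?r' u) (at u)"
      using Suc.prems(1)[of 0 u] u'
      by (auto intro!: has_vector_derivative_diff has_vector_derivative_sum d
            has_vector_derivative_add[OF has_vector_derivative_const, simplified] simp del: power_Suc fact_Suc)
    then have "(?r has_vector_derivative ?r' u) (at u)"
      by (simp add: sum.atMost_Suc_shift del: sum.atMost_Suc power_Suc fact_Suc)
    then show "(?r has_vector_derivative ?r' u) (at u within {-\<bar>t\<bar>..\<bar>t\<bar>})"
      by (rule has_vector_derivative_at_within)
    have "norm (?r' u) \<le> L * \<bar>u\<bar> ^ Suc K"
      using Suc.IH[of "\<lambda>k. h (Suc k)" u] Suc.prems u' by simp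
    also have "\<dots> \<le> L * \<bar>t\<bar> ^ Suc K"
      by (intro mult_left_mono power_mono u Suc.prems) auto
    finally show "norm (?r' u) \<le> L * \<bar>t\<bar> ^ Suc K" .
  qed
  moreover have "?r 0 = 0"
    by (simp add: sum.atMost_Suc_shift del: sum.atMost_Suc)
  ultimately show ?case by (simp add: mult_ac)
qed simp

text \<open>One-variable Taylor expansion along the integral curve. A common \<open>\<delta>\<close>
  and \<open>L\<close> for the whole ball is what allows iteration over the legs of a path, and the
  ball of radius \<open>R + 1\<close> contains the end points.\<close>

lemma flow_taylor:
  fixes f :: "nat \<Rightarrow> 'a::euclidean_space \<Rightarrow> 'a" and g :: "'a \<Rightarrow> 'b::euclidean_space"
  assumes "C1 (f j)" "j \<in> {1..m}" and CH: "CH m f K g"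
  shows "\<exists>\<delta> L. 0 < \<delta> \<and> 0 \<le> L \<and> (\<forall>x\<in>cball 0 R. \<forall>t. \<bar>t\<bar> < \<delta> \<longrightarrow> flow (f j) t x \<in> cball 0 (R + 1) \<and>
      norm (g (flow (f j) t x) - (\<Sum>k\<le>K. (t ^ k / fact k) *\<^sub>R hder f (replicate k j) g x)) \<le> L * \<bar>t\<bar> ^ Suc K)"
proof -
  have rep: "replicate K j \<in> words m K"
    using assms by (auto simp: words_def)
  then have "d_lipschitz_on m f (cball 0 (R + 1)) (hder f (replicate K j) g)"
    using CH by (auto simp: CH_def)
  then obtain L where L: "0 \<le> L" "\<And>t x y. flows_to (f j) t x y \<Longrightarrow> x \<in> cball 0 (R + 1) \<Longrightarrow> y \<in> cball 0 (R + 1) \<Longrightarrow>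
      norm (hder f (replicate K j) g y - hder f (replicate K j) g x) \<le> L * \<bar>t\<bar>"
    using assms(2) d_lipschitz_on_flow by metis
  obtain \<delta> where \<delta>: "0 < \<delta>" "\<forall>x\<in>cball 0 R. \<exists>\<gamma>. \<gamma> 0 = x \<and>
      (\<forall>t. \<bar>t\<bar> < \<delta> \<longrightarrow> (\<gamma> has_vector_derivative f j (\<gamma> t)) (at t) \<and> \<gamma> t \<in> cball 0 (R + 1))"
    using integral_curve_exists[OF assms(1), of R] by blast
  show ?thesis
  proof (rule exI[of _ \<delta>], rule exI[of _ L], rule conjI[OF \<delta>(1) conjI[OF L(1)]], rule ballI, intro allI impI)
    fix x :: 'a and t :: real assume x: "x \<in> cball 0 R" and t: "\<bar>t\<bar> < \<delta>"
    from \<delta>(2)[rule_format, OF x] obtain \<gamma> where \<gamma>: "\<gamma> 0 = x"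
      "\<And>t. \<bar>t\<bar> < \<delta> \<Longrightarrow> (\<gamma> has_vector_derivative f j (\<gamma> t)) (at t)" "\<And>t. \<bar>t\<bar> < \<delta> \<Longrightarrow> \<gamma> t \<in> cball 0 (R + 1)"
      by blast
    have fl: "flows_to (f j) t x (\<gamma> t)" if "\<bar>t\<bar> < \<delta>" for t
      using flows_to_along_curve[of \<delta> \<gamma> "f j" 0 t] \<gamma> \<delta>(1) that by simp
    have fe: "flow (f j) t x = \<gamma> t" using flow_eqI[OF assms(1) fl[OF t]] .
    let ?h = "\<lambda>k u. hder f (replicate k j) g (\<gamma> u)"
    have "norm (?h 0 t - (\<Sum>k\<le>K. (t ^ k / fact k) *\<^sub>R ?h k 0)) \<le> L * \<bar>t\<bar> ^ Suc K"
    proof (rule taylor_lipschitz_remainder[OF _ _ L(1) t])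
      fix k u assume k: "k < K" and u: "\<bar>u\<bar> < \<delta>"
      have "replicate K j = replicate (K - Suc k) j @ replicate (Suc k) j"
        using k by (subst replicate_add[symmetric]) simp
      then have "hder_exists f (replicate (Suc k) j) g"
        using CH rep by (metis CH_def hder_exists_append)
      then obtain l where l: "has_lie_deriv (f j) (hder f (replicate k j) g) (\<gamma> u) l"
        by auto
      then have "l = ?h (Suc k) u" by (simp add: has_lie_deriv_imp_lie_deriv)
      with l show "(?h k has_vector_derivative ?h (Suc k) u) (at u)"
        using has_lie_deriv_along_curve[OF assms(1) \<gamma>(2) u] by blast
    next
      fix u assume u: "\<bar>u\<bar> < \<delta>"
      show "norm (?h K u - ?h K 0) \<le> L * \<bar>u\<bar>"
        using L(2)[OF fl[OF u]] \<gamma>(1) \<gamma>(3)[OF u] x by auto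
    qed
    then show "flow (f j) t x \<in> cball 0 (R + 1) \<and>
        norm (g (flow (f j) t x) - (\<Sum>k\<le>K. (t ^ k / fact k) *\<^sub>R hder f (replicate k j) g x)) \<le> L * \<bar>t\<bar> ^ Suc K"
      using \<gamma>(1) \<gamma>(3)[OF t] by (simp add: fe)
  qed
qed

subsection \<open>Noncommutative power series\<close>

text \<open>Formal power series in noncommuting letters. A word stands for the composition of Lie
  derivatives along its letters, so the product, a sum over all cuts of a word, models composition
  of expansions.\<close>

typedef ncseries = "UNIV :: (nat list \<Rightarrow> real) set"
  morphisms coef NCS by simp

setup_lifting type_definition_ncseries

lemma ncseries_eqI: "(\<And>v. coef a v = coef b v) \<Longrightarrow> a = b"
  by (simp add: coef_inject[symmetric] fun_eq_iff)

instantiation ncseries :: ring_1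
begin

lift_definition zero_ncseries :: ncseries is "\<lambda>v. 0" .
lift_definition one_ncseries :: ncseries is "\<lambda>v. if v = [] then 1 else 0" .
lift_definition plus_ncseries :: "ncseries \<Rightarrow> ncseries \<Rightarrow> ncseries" is "\<lambda>a b v. a v + b v" .
lift_definition minus_ncseries :: "ncseries \<Rightarrow> ncseries \<Rightarrow> ncseries" is "\<lambda>a b v. a v - b v" .
lift_definition uminus_ncseries :: "ncseries \<Rightarrow> ncseries" is "\<lambda>a v. - a v" .
lift_definition times_ncseries :: "ncseries \<Rightarrow> ncseries \<Rightarrow> ncseries"
  is "\<lambda>a b v. \<Sum>i\<le>length v. a (take i v) * b (drop i v)" .

text \<open>Associativity is proved through the left derivative \<open>a \<mapsto> (\<lambda>v. a (j # v))\<close>, for which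
  the product obeys a Leibniz rule.\<close>

instance
proof
  have mult_Nil: "coef (a * b) [] = coef a [] * coef b []" for a b
    by (simp add: times_ncseries.rep_eq)
  have mult_Cons: "coef (a * b) (j # v) = coef a [] * coef b (j # v) + coef (NCS (\<lambda>v. coef a (j # v)) * b) v"
    for a b j v
    by (simp add: times_ncseries.rep_eq sum.atMost_Suc_shift NCS_inverse del: sum.atMost_Suc)
  have D: "NCS (\<lambda>v. coef (a * b) (j # v)) =
      NCS (\<lambda>v. coef a [] * coef b (j # v)) + NCS (\<lambda>v. coef a (j # v)) * b" for a b j
    by (rule ncseries_eqI) (simp add: mult_Cons NCS_inverse plus_ncseries.rep_eq)
  have distrib_right: "(a + b) * c = a * c + b * c" for a b c :: ncseries
    by (rule ncseries_eqI)
       (simp add: times_ncseries.rep_eq plus_ncseries.rep_eq sum.distrib distrib_right)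
  have scale: "coef (NCS (\<lambda>v. r * coef b (j # v)) * c) v = r * coef (NCS (\<lambda>v. coef b (j # v)) * c) v" for r b j c v
    by (simp add: times_ncseries.rep_eq NCS_inverse sum_distrib_left mult.assoc)
  have "coef (a * b * c) v = coef (a * (b * c)) v" for a b c v
  proof (induction v arbitrary: a)
    case (Cons j v)
    have "coef (a * b * c) (j # v) =
        coef (a * b) [] * coef c (j # v) + coef (NCS (\<lambda>v. coef (a * b) (j # v)) * c) v"
      by (rule mult_Cons)
    also have "\<dots> = coef a [] * coef (b * c) (j # v) + coef (NCS (\<lambda>v. coef a (j # v)) * b * c) v"
      by (simp add: D distrib_right plus_ncseries.rep_eq scale mult_Nil) (simp add: mult_Cons algebra_simps)
    also have "\<dots> = coef (a * (b * c)) (j # v)"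
      by (simp only: Cons.IH mult_Cons)
    finally show ?case .
  qed (simp add: mult_Nil)
  then show "a * b * c = a * (b * c)" for a b c :: ncseries
    by (rule ncseries_eqI)
  show "(a + b) * c = a * c + b * c" for a b c :: ncseries
    by (rule distrib_right)
  show "a * (b + c) = a * b + a * c" for a b c :: ncseries
    by (rule ncseries_eqI)
       (simp add: times_ncseries.rep_eq plus_ncseries.rep_eq sum.distrib distrib_left)
  show "1 * a = a" for a :: ncseries
  proof (rule ncseries_eqI)
    show "coef (1 * a) v = coef a v" for v
      by (cases v) (simp_all add: times_ncseries.rep_eq one_ncseries.rep_eq sum.atMost_Suc_shift del: sum.atMost_Suc)
  qed
  show "a * 1 = a" for a :: ncseries
  proof (rule ncseries_eqI)
    fix v :: "nat list"
    have "coef (a * 1) v = (\<Sum>i\<in>{length v}. coef a (take i v) * coef 1 (drop i v))"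
      unfolding times_ncseries.rep_eq
      by (rule sum.mono_neutral_right) (auto simp: one_ncseries.rep_eq)
    then show "coef (a * 1) v = coef a v"
      by (simp add: one_ncseries.rep_eq)
  qed
  show "(0::ncseries) \<noteq> 1"
    by transfer (auto simp: fun_eq_iff)
qed (transfer; simp add: fun_eq_iff algebra_simps)+

end

lemmas coef_ring_simps = plus_ncseries.rep_eq minus_ncseries.rep_eq uminus_ncseries.rep_eq
  zero_ncseries.rep_eq one_ncseries.rep_eq

section \<open>Degree filtration, letters and their exponentials\<close>

text \<open>A word of length \<open>k\<close> will carry the weight t^k, so congruence modulo series
  of order at least \<open>k\<close> is the algebraic counterpart of an error O(t^k).\<close>

definition order_ge :: "nat \<Rightarrow> ncseries \<Rightarrow> bool" where
  "order_ge k a \<longleftrightarrow> (\<forall>v. length v < k \<longrightarrow> coef a v = 0)"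

lemma order_ge_0 [simp]: "order_ge 0 a"
  by (simp add: order_ge_def)

lemma order_ge_mono: "order_ge k a \<Longrightarrow> i \<le> k \<Longrightarrow> order_ge i a"
  by (auto simp: order_ge_def)

lemma order_ge_add: "order_ge k a \<Longrightarrow> order_ge k b \<Longrightarrow> order_ge k (a + b)"
  and order_ge_diff: "order_ge k a \<Longrightarrow> order_ge k b \<Longrightarrow> order_ge k (a - b)"
  by (auto simp: order_ge_def coef_ring_simps)

text \<open>When a word shorter than \<open>i + k\<close> is cut in two, the left part is shorter
  than \<open>i\<close> or the right part is shorter than \<open>k\<close>.\<close>

lemma order_ge_mult:
  assumes "order_ge i a" "order_ge k b"
  shows "order_ge (i + k) (a * b)"
  unfolding order_ge_def
proof (intro allI impI)
  fix v :: "nat list" assume v: "length v < i + k"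
  have "coef a (take p v) * coef b (drop p v) = 0" for p
  proof (cases "p < i")
    case True
    then show ?thesis using assms by (auto simp: order_ge_def)
  next
    case False
    then have "length (drop p v) < k \<or> length (take p v) < i" using v by auto
    then show ?thesis using assms by (auto simp: order_ge_def)
  qed
  then show "coef (a * b) v = 0"
    unfolding times_ncseries.rep_eq by (intro sum.neutral ballI)
qed

definition letter :: "nat \<Rightarrow> ncseries" where
  "letter j = NCS (\<lambda>v. if v = [j] then 1 else 0)"

lemma coef_letter_mult:
  "coef (letter j * a) v = (case v of [] \<Rightarrow> 0 | i # u \<Rightarrow> if i = j then coef a u else 0)"
proof (cases v)
  case (Cons i u)
  have "coef (letter j * a) v = (\<Sum>p\<in>{1}. coef (letter j) (take p v) * coef a (drop p v))"
    unfolding times_ncseries.rep_eq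
    by (rule sum.mono_neutral_right) (auto simp: letter_def NCS_inverse Cons take_Cons' split: if_splits)
  then show ?thesis by (simp add: Cons letter_def NCS_inverse)
qed (simp add: times_ncseries.rep_eq letter_def NCS_inverse)

lemma coef_mult_letter_snoc: "coef (a * letter j) (u @ [i]) = (if i = j then coef a u else 0)"
proof -
  have "coef (a * letter j) (u @ [i]) =
      (\<Sum>p\<in>{length u}. coef a (take p (u @ [i])) * coef (letter j) (drop p (u @ [i])))"
    unfolding times_ncseries.rep_eq
  proof (rule sum.mono_neutral_right)
    show "\<forall>p\<in>{..length (u @ [i])} - {length u}. coef a (take p (u @ [i])) * coef (letter j) (drop p (u @ [i])) = 0"
    proof
      fix p assume "p \<in> {..length (u @ [i])} - {length u}"
      then have "length (drop p (u @ [i])) \<noteq> 1" by auto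
      then have "drop p (u @ [i]) \<noteq> [j]" by (metis length_Cons list.size(3) One_nat_def)
      then show "coef a (take p (u @ [i])) * coef (letter j) (drop p (u @ [i])) = 0"
        by (simp add: letter_def NCS_inverse del: drop_append)
    qed
  qed auto
  then show ?thesis by (simp add: letter_def NCS_inverse)
qed

text \<open>The exponential of \<open>r\<close> times \<open>letter j\<close>, that is, the formal
  Taylor series of the flow along field \<open>j\<close> for time \<open>r\<close>.\<close>

definition exp_letter :: "real \<Rightarrow> nat \<Rightarrow> ncseries" where
  "exp_letter r j = NCS (\<lambda>v. if set v \<subseteq> {j} then r ^ length v / fact (length v) else 0)"

lemma coef_exp_letter:
  "coef (exp_letter r j) v = (if set v \<subseteq> {j} then r ^ length v / fact (length v) else 0)"
  by (simp add: exp_letter_def NCS_inverse)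

text \<open>Both factors involve powers of one letter only, so this is the binomial theorem. It
  makes \<open>exp_letter (- r) j\<close> inverse to \<open>exp_letter r j\<close>.\<close>

lemma exp_letter_add: "exp_letter r j * exp_letter s j = exp_letter (r + s) j"
proof (rule ncseries_eqI)
  fix v :: "nat list"
  show "coef (exp_letter r j * exp_letter s j) v = coef (exp_letter (r + s) j) v"
  proof (cases "set v \<subseteq> {j}")
    case True
    then have "set (take i v) \<subseteq> {j} \<and> set (drop i v) \<subseteq> {j}" for i
      using set_take_subset[of i v] set_drop_subset[of i v] by blast
    then have "coef (exp_letter r j * exp_letter s j) v =
        (\<Sum>i\<le>length v. (r ^ i / fact i) * (s ^ (length v - i) / fact (length v - i)))"
      unfolding times_ncseries.rep_eq by (intro sum.cong) (auto simp: coef_exp_letter min_absorb2)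
    also have "\<dots> = (r + s) ^ length v / fact (length v)"
      using exp_series_add_commuting[of r s "length v"] by (simp add: divide_inverse mult_ac)
    finally show ?thesis using True by (simp add: coef_exp_letter)
  next
    case False
    have "coef (exp_letter r j) (take i v) * coef (exp_letter s j) (drop i v) = 0" for i
      using False set_append[of "take i v" "drop i v"] by (auto simp: coef_exp_letter)
    then have "coef (exp_letter r j * exp_letter s j) v = 0"
      unfolding times_ncseries.rep_eq by (intro sum.neutral ballI)
    then show ?thesis using False by (simp add: coef_exp_letter)
  qed
qed

lemma exp_letter_0: "exp_letter 0 j = 1"
  by (rule ncseries_eqI) (auto simp: coef_exp_letter one_ncseries.rep_eq)

lemma order_ge_exp_letter:
  "order_ge 1 (exp_letter r j - 1)" "order_ge 2 (exp_letter 1 j - 1 - letter j)"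
proof -
  show "order_ge 1 (exp_letter r j - 1)"
    by (auto simp: order_ge_def coef_ring_simps coef_exp_letter)
  have "coef (exp_letter 1 j - 1 - letter j) v = 0" if "length v < 2" for v
  proof -
    from that consider "v = []" | i where "v = [i]"
      by (cases v) auto
    then show ?thesis
      by cases (auto simp: coef_ring_simps coef_exp_letter letter_def NCS_inverse)
  qed
  then show "order_ge 2 (exp_letter 1 j - 1 - letter j)"
    by (simp add: order_ge_def)
qed

section \<open>Iterated brackets and group commutators\<close>

text \<open>The right-nested Lie bracket of the letters in the free associative algebra; the value
  at the empty word is a dummy.\<close>

fun bracket_series :: "nat list \<Rightarrow> ncseries" where
  "bracket_series [] = 0"
| "bracket_series [j] = letter j"
| "bracket_series (j # v) = letter j * bracket_series v - bracket_series v * letter j"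

lemma order_ge_letter: "order_ge 1 (letter j)"
  by (auto simp: order_ge_def letter_def NCS_inverse)

lemma order_ge_bracket_series: "order_ge (length w) (bracket_series w)"
proof (induction w rule: bracket_series.induct)
  case (3 j i v)
  then show ?case
    using order_ge_mult[OF order_ge_letter 3(1)] order_ge_mult[OF 3(1) order_ge_letter]
    by (auto intro!: order_ge_diff)
qed (simp_all add: order_ge_letter[simplified])

text \<open>\<open>X C X\<^sup>-\<^sup>1 C\<^sup>-\<^sup>1 - 1 = (X C - C X) X\<^sup>-\<^sup>1 C\<^sup>-\<^sup>1\<close>, and
  \<open>X C - C X\<close> does not see the constant terms of \<open>X\<close> and \<open>C\<close>.\<close>

lemma order_ge_group_commutator:
  assumes x: "order_ge 1 x" "order_ge 2 (X - 1 - x)" "X * X' = 1" "order_ge 1 (X' - 1)"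
    and c: "1 \<le> k" "order_ge k c" "order_ge (Suc k) (C - 1 - c)" "C * C' = 1" "order_ge 1 (C' - 1)"
  shows "order_ge (Suc (Suc k)) (X * C * X' * C' - 1 - (x * c - c * x))"
proof -
  define p q where "p = X - 1 - x" and "q = C - 1 - c"
  have XC: "X * C - C * X = (x * c - c * x) + (x * q - q * x) + (p * (c + q) - (c + q) * p)"
    by (simp add: p_def q_def algebra_simps)
  have o: "order_ge 2 p" "order_ge (Suc k) q" using x c by (simp_all add: p_def q_def)
  have xc: "order_ge (Suc k) (x * c - c * x)"
    using order_ge_mult[OF x(1) c(2)] order_ge_mult[OF c(2) x(1)] by (auto intro: order_ge_diff)
  have r: "order_ge (Suc (Suc k)) (x * q - q * x)"
    using order_ge_mult[OF x(1) o(2)] order_ge_mult[OF o(2) x(1)] by (auto intro: order_ge_diff)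
  have cq: "order_ge k (c + q)"
    using order_ge_add[OF c(2) order_ge_mono[OF o(2)]] by simp
  have r': "order_ge (Suc (Suc k)) (p * (c + q) - (c + q) * p)"
    using order_ge_mult[OF o(1) cq] order_ge_mult[OF cq o(1)] by (auto intro: order_ge_diff)
  define y where "y = X' * C'"
  have y: "order_ge 1 (y - 1)"
  proof -
    have "y - 1 = (X' - 1) * C' + (C' - 1)" by (simp add: y_def algebra_simps)
    moreover have "order_ge 1 ((X' - 1) * C')"
      using order_ge_mult[OF x(4) order_ge_0[of C']] by simp
    ultimately show ?thesis using order_ge_add c(5) by metis
  qed
  have XCo: "order_ge (Suc k) (X * C - C * X)"
    unfolding XC using xc r r' by (intro order_ge_add) (auto intro: order_ge_mono)
  have "C * X * y = 1" using x(3) c(4) by (metis y_def mult.assoc mult_1_right)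
  \<comment> \<open>Write \<open>y\<close> as 1 plus \<open>y - 1\<close>. The bracket of
    \<open>X\<close> and \<open>C\<close>, of order \<open>Suc k\<close>, gains a degree from
    \<open>y - 1\<close>; its product with 1 leaves only the two error terms after subtraction of
    \<open>x * c - c * x\<close>.\<close>
  then have "X * C * X' * C' - 1 - (x * c - c * x)
      = (X * C - C * X) * (y - 1) + ((x * q - q * x) + (p * (c + q) - (c + q) * p))"
    using XC by (simp add: y_def algebra_simps)
  then show ?thesis
    using order_ge_mult[OF XCo y] order_ge_add[OF r r'] by (simp add: order_ge_add)
qed

section \<open>Permutation formula for iterated brackets\<close>

lemma finite_words: "finite (words m k)"
  using finite_lists_length_eq[of "{1..m}" k] by (simp add: words_def conj_commute)

text \<open>The support of \<open>letter j * a\<close> consists of words beginning with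
  \<open>j\<close>. This and its mirror image turn multiplication by a letter into an operation on
  the argument of \<open>H\<close>.\<close>

lemma sum_words_letter_mult:
  fixes H :: "nat list \<Rightarrow> 'b::real_vector"
  assumes "j \<in> {1..m}"
  shows "(\<Sum>u\<in>words m (Suc k). coef (letter j * a) u *\<^sub>R H u) = (\<Sum>u\<in>words m k. coef a u *\<^sub>R H (j # u))"
proof -
  have "(\<Sum>u\<in>words m (Suc k). coef (letter j * a) u *\<^sub>R H u)
      = (\<Sum>u\<in>(#) j ` words m k. coef (letter j * a) u *\<^sub>R H u)"
  proof (rule sum.mono_neutral_right[OF finite_words])
    show "(#) j ` words m k \<subseteq> words m (Suc k)" using assms by (auto simp: words_def)
    show "\<forall>u\<in>words m (Suc k) - (#) j ` words m k. coef (letter j * a) u *\<^sub>R H u = 0"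
      by (auto simp: words_def coef_letter_mult length_Suc_conv image_iff)
  qed
  also have "\<dots> = (\<Sum>u\<in>words m k. coef a u *\<^sub>R H (j # u))"
    by (subst sum.reindex) (auto simp: coef_letter_mult)
  finally show ?thesis .
qed

lemma sum_words_mult_letter:
  fixes H :: "nat list \<Rightarrow> 'b::real_vector"
  assumes "j \<in> {1..m}"
  shows "(\<Sum>u\<in>words m (Suc k). coef (a * letter j) u *\<^sub>R H u) = (\<Sum>u\<in>words m k. coef a u *\<^sub>R H (u @ [j]))"
proof -
  have "(\<Sum>u\<in>words m (Suc k). coef (a * letter j) u *\<^sub>R H u)
      = (\<Sum>u\<in>(\<lambda>u. u @ [j]) ` words m k. coef (a * letter j) u *\<^sub>R H u)"
  proof (rule sum.mono_neutral_right[OF finite_words])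
    show "(\<lambda>u. u @ [j]) ` words m k \<subseteq> words m (Suc k)" using assms by (auto simp: words_def)
    show "\<forall>u\<in>words m (Suc k) - (\<lambda>u. u @ [j]) ` words m k. coef (a * letter j) u *\<^sub>R H u = 0"
    proof
      fix u assume u: "u \<in> words m (Suc k) - (\<lambda>u. u @ [j]) ` words m k"
      then obtain v i where v: "u = v @ [i]" by (cases u rule: rev_cases) (auto simp: words_def)
      with u have "i \<noteq> j" by (auto simp: words_def)
      then show "coef (a * letter j) u *\<^sub>R H u = 0" by (simp add: v coef_mult_letter_snoc)
    qed
  qed
  also have "\<dots> = (\<Sum>u\<in>words m k. coef a u *\<^sub>R H (u @ [j]))"
    by (subst sum.reindex) (auto simp: coef_mult_letter_snoc inj_on_def)
  finally show ?thesis .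
qed

text \<open>The recursion shifts permutations into maps that may fail to be permutations outside
  \<open>{1..l}\<close>; this lets genuine permutations replace them.\<close>

lemma perm_coeff_cong:
  "(\<And>i. i \<in> {1..l} \<Longrightarrow> \<sigma> i = \<tau> i) \<Longrightarrow> perm_coeff l \<sigma> = perm_coeff l \<tau>"
proof (induction l \<sigma> arbitrary: \<tau> rule: perm_coeff.induct)
  case (3 k \<sigma>)
  have "perm_coeff (Suc k) (\<lambda>i. \<sigma> (i + 1) - 1) = perm_coeff (Suc k) (\<lambda>i. \<tau> (i + 1) - 1)" if "\<sigma> 1 = 1"
    using that 3(3) by (intro 3(1)) auto
  moreover have "perm_coeff (Suc k) (\<lambda>i. \<sigma> i - 1) = perm_coeff (Suc k) (\<lambda>i. \<tau> i - 1)"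
    if "\<sigma> 1 \<noteq> 1" "\<sigma> (Suc (Suc k)) = 1"
    using that 3(3) by (intro 3(2)) auto
  moreover have "\<sigma> 1 = \<tau> 1" "\<sigma> (Suc (Suc k)) = \<tau> (Suc (Suc k))" using 3(3) by auto
  ultimately show ?case by auto
qed simp_all

lemma permutes_pos: "\<sigma> permutes {1..l::nat} \<Longrightarrow> i \<in> {1..l} \<Longrightarrow> 1 \<le> \<sigma> i \<and> \<sigma> i \<le> l"
  using permutes_in_image[of \<sigma> "{1..l}" i] by simp

text \<open>The bijection is \<tau> (i + 1) = \<sigma> i + 1: the letter \<open>j\<close> stays in
  front while \<sigma> rearranges the rest.\<close>

lemma sum_permutes_fix_first:
  fixes H :: "nat list \<Rightarrow> 'b::real_vector"
  assumes l: "length v = l"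
  shows "(\<Sum>\<tau> | \<tau> permutes {1..Suc l} \<and> \<tau> 1 = 1. perm_coeff l (\<lambda>i. \<tau> (i + 1) - 1) *\<^sub>R H (perm_word \<tau> (j # v)))
       = (\<Sum>\<sigma> | \<sigma> permutes {1..l}. perm_coeff l \<sigma> *\<^sub>R H (j # perm_word \<sigma> v))"
proof (rule sum.reindex_bij_witness[where i = "\<lambda>\<sigma> i. if i \<le> 1 then i else Suc (\<sigma> (i - 1))"
      and j = "\<lambda>\<tau> i. \<tau> (i + 1) - 1"]; (elim CollectE conjE)?)
  fix \<tau> assume p: "\<tau> permutes {1..Suc l}" and t1: "\<tau> 1 = 1"
  \<comment> \<open>Past position 1 the values avoid 0 and 1, so truncated subtraction of 1 loses no
    information.\<close>
  have ge: "\<tau> (Suc i) \<ge> 2" if "i \<ge> 1" for i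
  proof -
    have "\<tau> (Suc i) \<noteq> \<tau> 1" using permutes_inj[OF p] that by (auto dest!: injD)
    moreover have "\<tau> (Suc i) \<noteq> 0" using permutes_inj[OF p] permutes_not_in[OF p, of 0] by (auto dest!: injD[of _ 0 "Suc i"])
    ultimately show ?thesis using t1 by auto
  qed
  show "(\<lambda>i. if i \<le> 1 then i else Suc (\<tau> (i - 1 + 1) - 1)) = \<tau>"
  proof
    fix i
    show "(if i \<le> 1 then i else Suc (\<tau> (i - 1 + 1) - 1)) = \<tau> i"
    proof (cases "i \<le> 1")
      case True
      then have "i = 0 \<or> i = 1" by auto
      then show ?thesis using t1 permutes_not_in[OF p, of 0] by auto
    next
      case False
      then have "2 \<le> \<tau> (Suc (i - 1))" by (intro ge) simp
      then show ?thesis using False by simp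
    qed
  qed
  show "(\<lambda>i. \<tau> (i + 1) - 1) \<in> {\<sigma>. \<sigma> permutes {1..l}}"
  proof (rule CollectI, rule inj_imp_permutes)
    show "inj_on (\<lambda>i. \<tau> (i + 1) - 1) {1..l}"
    proof (rule inj_onI)
      fix a b assume "a \<in> {1..l}" "b \<in> {1..l}" "\<tau> (a + 1) - 1 = \<tau> (b + 1) - 1"
      then have "\<tau> (Suc a) = \<tau> (Suc b)" using ge[of a] ge[of b] by auto
      then show "a = b" using permutes_inj[OF p] by (auto dest: injD)
    qed
    show "\<tau> (i + 1) - 1 \<in> {1..l}" if "i \<in> {1..l}" for i
      using that ge[of i] permutes_pos[OF p, of "Suc i"] by auto
    show "\<tau> (i + 1) - 1 = i" if "i \<notin> {1..l}" for i
      using that t1 permutes_not_in[OF p, of "Suc i"] by (cases "i = 0") auto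
  qed simp
  have "perm_word \<tau> (j # v) = j # perm_word (\<lambda>i. \<tau> (i + 1) - 1) v"
  proof (rule nth_equalityI)
    fix i assume "i < length (perm_word \<tau> (j # v))"
    then show "perm_word \<tau> (j # v) ! i = (j # perm_word (\<lambda>i. \<tau> (i + 1) - 1) v) ! i"
      using t1 ge[of i] by (cases i) (auto simp: perm_word_def nth_Cons' simp del: upt_Suc)
  qed (simp add: perm_word_def)
  then show "perm_coeff l (\<lambda>i. \<tau> (i + 1) - 1) *\<^sub>R H (j # perm_word (\<lambda>i. \<tau> (i + 1) - 1) v) =
      perm_coeff l (\<lambda>i. \<tau> (i + 1) - 1) *\<^sub>R H (perm_word \<tau> (j # v))" by simp
next
  fix \<sigma> assume p: "\<sigma> permutes {1..l}"
  let ?t = "\<lambda>i. if i \<le> 1 then i else Suc (\<sigma> (i - 1))"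
  show "(\<lambda>i. ?t (i + 1) - 1) = \<sigma>"
    using permutes_not_in[OF p, of 0] by (auto simp: fun_eq_iff)
  have s0: "\<sigma> i \<noteq> 0" if "i \<noteq> 0" for i
    using permutes_inj[OF p] permutes_not_in[OF p, of 0] that by (auto dest!: injD[of _ 0 i])
  have "?t permutes {1..Suc l}"
  proof (rule inj_imp_permutes)
    show "inj_on ?t {1..Suc l}"
    proof (rule inj_onI)
      fix a b assume ab: "a \<in> {1..Suc l}" "b \<in> {1..Suc l}" and eq: "?t a = ?t b"
      have "\<sigma> (a - 1) = \<sigma> (b - 1) \<Longrightarrow> a - 1 = b - 1" using permutes_inj[OF p] by (rule injD)
      then show "a = b"
        using ab eq s0[of "a - 1"] s0[of "b - 1"] by (cases "a = 1"; cases "b = 1") simp_all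
    qed
    show "?t i \<in> {1..Suc l}" if "i \<in> {1..Suc l}" for i
    proof (cases "i \<le> 1")
      case False
      then have "i - 1 \<in> {1..l}" using that by auto
      then show ?thesis using permutes_pos[OF p, of "i - 1"] False by simp
    qed (use that in auto)
    show "?t i = i" if "i \<notin> {1..Suc l}" for i
    proof (cases "i \<le> 1")
      case False
      then have "i - 1 \<notin> {1..l}" using that by auto
      then show ?thesis using permutes_not_in[OF p, of "i - 1"] False by simp
    qed simp
  qed simp
  then show "?t \<in> {\<tau>. \<tau> permutes {1..Suc l} \<and> \<tau> 1 = 1}" by simp
qed

text \<open>The mirror case, with \<open>j\<close> moved to the end. Here the shifted map is not the
  identity outside \<open>{1..l}\<close>, so the bijection resets it there.\<close>

lemma sum_permutes_fix_last:
  fixes H :: "nat list \<Rightarrow> 'b::real_vector"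
  assumes l: "length v = l"
  shows "(\<Sum>\<tau> | \<tau> permutes {1..Suc l} \<and> \<tau> (Suc l) = 1. perm_coeff l (\<lambda>i. \<tau> i - 1) *\<^sub>R H (perm_word \<tau> (j # v)))
       = (\<Sum>\<sigma> | \<sigma> permutes {1..l}. perm_coeff l \<sigma> *\<^sub>R H (perm_word \<sigma> v @ [j]))"
proof (rule sum.reindex_bij_witness[where i = "\<lambda>\<sigma> i. if i = Suc l then 1 else if i \<in> {1..l} then Suc (\<sigma> i) else i"
      and j = "\<lambda>\<tau> i. if i \<in> {1..l} then \<tau> i - 1 else i"]; (elim CollectE conjE)?)
  fix \<tau> assume p: "\<tau> permutes {1..Suc l}" and t1: "\<tau> (Suc l) = 1"
  let ?s = "\<lambda>i. if i \<in> {1..l} then \<tau> i - 1 else i"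
  have ge: "\<tau> i \<ge> 2" if "i \<in> {1..l}" for i
  proof -
    have "\<tau> i \<noteq> \<tau> (Suc l)" using permutes_inj[OF p] that by (auto dest!: injD)
    then show ?thesis using t1 permutes_pos[OF p, of i] that by auto
  qed
  show "(\<lambda>i. if i = Suc l then 1 else if i \<in> {1..l} then Suc (?s i) else i) = \<tau>"
  proof
    fix i
    show "(if i = Suc l then 1 else if i \<in> {1..l} then Suc (?s i) else i) = \<tau> i"
      using ge[of i] t1 permutes_not_in[OF p, of i] by auto
  qed
  show "?s \<in> {\<sigma>. \<sigma> permutes {1..l}}"
  proof (rule CollectI, rule inj_imp_permutes)
    show "inj_on ?s {1..l}"
    proof (rule inj_onI)
      fix a b assume "a \<in> {1..l}" "b \<in> {1..l}" "?s a = ?s b"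
      then have "\<tau> a = \<tau> b" using ge[of a] ge[of b] by auto
      then show "a = b" using permutes_inj[OF p] by (auto dest: injD)
    qed
    show "?s i \<in> {1..l}" if "i \<in> {1..l}" for i
      using that ge[of i] permutes_pos[OF p, of i] by auto
  qed auto
  have "perm_word \<tau> (j # v) = perm_word ?s v @ [j]"
  proof (rule nth_equalityI)
    fix i assume "i < length (perm_word \<tau> (j # v))"
    then consider "i < l" | "i = l" using l by (auto simp: perm_word_def less_Suc_eq simp del: upt_Suc)
    then show "perm_word \<tau> (j # v) ! i = (perm_word ?s v @ [j]) ! i"
      by cases (use t1 l ge[of "Suc i"] in \<open>auto simp: perm_word_def nth_append nth_Cons' numeral_2_eq_2 simp del: upt_Suc\<close>)
  qed (simp add: perm_word_def)
  moreover have "perm_coeff l ?s = perm_coeff l (\<lambda>i. \<tau> i - 1)"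
    by (rule perm_coeff_cong) simp
  ultimately show "perm_coeff l ?s *\<^sub>R H (perm_word ?s v @ [j]) =
      perm_coeff l (\<lambda>i. \<tau> i - 1) *\<^sub>R H (perm_word \<tau> (j # v))" by simp
next
  fix \<sigma> assume p: "\<sigma> permutes {1..l}"
  let ?t = "\<lambda>i. if i = Suc l then 1 else if i \<in> {1..l} then Suc (\<sigma> i) else i"
  show "(\<lambda>i. if i \<in> {1..l} then ?t i - 1 else i) = \<sigma>"
  proof
    show "(if i \<in> {1..l} then ?t i - 1 else i) = \<sigma> i" for i
      using permutes_not_in[OF p, of i] by (cases "i \<in> {1..l}") auto
  qed
  have "?t permutes {1..Suc l}"
  proof (rule inj_imp_permutes)
    have mem: "a = Suc l \<or> a \<in> {1..l} \<and> a \<noteq> Suc l \<and> 1 \<le> \<sigma> a" if "a \<in> {1..Suc l}" for a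
      using that permutes_pos[OF p, of a] by (cases "a = Suc l") auto
    show "inj_on ?t {1..Suc l}"
    proof (rule inj_onI)
      fix a b assume ab: "a \<in> {1..Suc l}" "b \<in> {1..Suc l}" and eq: "?t a = ?t b"
      have "\<sigma> a = \<sigma> b \<Longrightarrow> a = b" using permutes_inj[OF p] by (rule injD)
      then show "a = b"
        using mem[OF ab(1)] mem[OF ab(2)] eq by (elim disjE conjE) simp_all
    qed
    show "?t i \<in> {1..Suc l}" if "i \<in> {1..Suc l}" for i
      using that permutes_pos[OF p, of i] by auto
  qed auto
  then show "?t \<in> {\<tau>. \<tau> permutes {1..Suc l} \<and> \<tau> (Suc l) = 1}" by simp
qed

text \<open>The recursion of \<open>perm_coeff\<close> is the expansion of a bracket: permutations
  with \<tau> 1 = 1 yield the product with \<open>letter j\<close> on the left, those sending the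
  last place to 1 the product on the right, with a minus sign. \<open>H\<close> varies because the
  induction applies the claim to \<open>H\<close> after a letter is prefixed or appended.\<close>

lemma sum_words_bracket_series:
  fixes H :: "nat list \<Rightarrow> 'b::real_vector"
  assumes "w \<noteq> []" "set w \<subseteq> {1..m}"
  shows "(\<Sum>u\<in>words m (length w). coef (bracket_series w) u *\<^sub>R H u) =
    (\<Sum>\<sigma> | \<sigma> permutes {1..length w}. perm_coeff (length w) \<sigma> *\<^sub>R H (perm_word \<sigma> w))"
  using assms
proof (induction w arbitrary: H rule: bracket_series.induct)
  case (2 j)
  have "{\<sigma>::nat \<Rightarrow> nat. \<sigma> permutes {Suc 0..Suc 0}} = {id}"
    by auto
  moreover have "(\<Sum>u\<in>words m 1. coef (letter j) u *\<^sub>R H u) = (\<Sum>u\<in>{[j]}. coef (letter j) u *\<^sub>R H u)"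
    by (rule sum.mono_neutral_right[OF finite_words])
       (use 2 in \<open>auto simp: words_def letter_def NCS_inverse\<close>)
  ultimately show ?case by (simp add: letter_def NCS_inverse perm_word_def)
next
  case (3 j i v)
  define v' where "v' = i # v"
  define l where "l = length v'"
  then obtain k where k: "l = Suc k" by (simp add: v'_def)
  have j: "j \<in> {1..m}" and IH: "\<And>H :: nat list \<Rightarrow> 'b. (\<Sum>u\<in>words m l. coef (bracket_series v') u *\<^sub>R H u) =
      (\<Sum>\<sigma> | \<sigma> permutes {1..l}. perm_coeff l \<sigma> *\<^sub>R H (perm_word \<sigma> v'))"
    using 3 by (auto simp: v'_def l_def)
  let ?P = "{\<tau>. \<tau> permutes {1..Suc l}}"
  have fin: "finite ?P" by (simp add: finite_permutations)
  \<comment> \<open>An injective \<tau> cannot send both end positions to 1, these being distinct,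
    so the nested conditional is a difference of two independent ones.\<close>
  have split: "perm_coeff (Suc l) \<tau> *\<^sub>R z =
      (if \<tau> 1 = 1 then perm_coeff l (\<lambda>i. \<tau> (i + 1) - 1) *\<^sub>R z else 0) -
      (if \<tau> (Suc l) = 1 then perm_coeff l (\<lambda>i. \<tau> i - 1) *\<^sub>R z else 0)"
    if "\<tau> \<in> ?P" for \<tau> and z :: 'b
  proof -
    have "inj \<tau>" using that permutes_inj by blast
    then have "\<not> (\<tau> 1 = 1 \<and> \<tau> (Suc l) = 1)" using injD[of \<tau> 1 "Suc l"] k by auto
    then show ?thesis by (auto simp: k)
  qed
  have "(\<Sum>\<tau>\<in>?P. perm_coeff (Suc l) \<tau> *\<^sub>R H (perm_word \<tau> (j # v')))
      = (\<Sum>\<tau>\<in>?P. if \<tau> 1 = 1 then perm_coeff l (\<lambda>i. \<tau> (i + 1) - 1) *\<^sub>R H (perm_word \<tau> (j # v')) else 0)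
      - (\<Sum>\<tau>\<in>?P. if \<tau> (Suc l) = 1 then perm_coeff l (\<lambda>i. \<tau> i - 1) *\<^sub>R H (perm_word \<tau> (j # v')) else 0)"
    by (simp only: split sum_subtractf cong: sum.cong)
  also have "\<dots> = (\<Sum>\<tau> | \<tau> permutes {1..Suc l} \<and> \<tau> 1 = 1. perm_coeff l (\<lambda>i. \<tau> (i + 1) - 1) *\<^sub>R H (perm_word \<tau> (j # v')))
      - (\<Sum>\<tau> | \<tau> permutes {1..Suc l} \<and> \<tau> (Suc l) = 1. perm_coeff l (\<lambda>i. \<tau> i - 1) *\<^sub>R H (perm_word \<tau> (j # v')))"
    by (simp only: sum.inter_filter[OF fin, symmetric] mem_Collect_eq)
  also have "\<dots> = (\<Sum>\<sigma> | \<sigma> permutes {1..l}. perm_coeff l \<sigma> *\<^sub>R H (j # perm_word \<sigma> v'))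
      - (\<Sum>\<sigma> | \<sigma> permutes {1..l}. perm_coeff l \<sigma> *\<^sub>R H (perm_word \<sigma> v' @ [j]))"
    by (simp only: sum_permutes_fix_first[OF l_def[symmetric]] sum_permutes_fix_last[OF l_def[symmetric]])
  also have "\<dots> = (\<Sum>u\<in>words m (Suc l). coef (letter j * bracket_series v' - bracket_series v' * letter j) u *\<^sub>R H u)"
    by (simp add: coef_ring_simps scaleR_diff_left sum_subtractf sum_words_letter_mult[OF j] sum_words_mult_letter[OF j] IH)
  finally show ?case by (simp add: v'_def l_def)
qed simp

subsection \<open>Expansions along iterated commutators of flows\<close>

text \<open>A path \<open>[(r\<^sub>1, j\<^sub>1), \<dots>]\<close> prescribes flows along \<open>X\<^bsub>j\<^sub>i\<^esub>\<close> for time \<open>t r\<^sub>i\<close>, the first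
  entry acting first on the point, hence last on functions.\<close>

primrec path_flow :: "(nat \<Rightarrow> 'a::euclidean_space \<Rightarrow> 'a) \<Rightarrow> (real \<times> nat) list \<Rightarrow> real \<Rightarrow> 'a \<Rightarrow> 'a" where
  "path_flow f [] t x = x"
| "path_flow f (p # ps) t x = path_flow f ps t (flow (f (snd p)) (t * fst p) x)"

primrec path_series :: "(real \<times> nat) list \<Rightarrow> ncseries" where
  "path_series [] = 1"
| "path_series (p # ps) = exp_letter (fst p) (snd p) * path_series ps"

definition path_inv :: "(real \<times> nat) list \<Rightarrow> (real \<times> nat) list" where
  "path_inv ps = rev (map (apfst uminus) ps)"

text \<open>The group commutator of the flow of the first letter with the path of the tail, arranged
  so that its series has the form \<open>X * C * X' * C'\<close>.\<close>

fun bracket_path :: "nat list \<Rightarrow> (real \<times> nat) list" where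
  "bracket_path [] = []"
| "bracket_path [j] = [(1, j)]"
| "bracket_path (j # v) = (1, j) # bracket_path v @ (-1, j) # path_inv (bracket_path v)"

lemma path_series_append: "path_series (ps @ qs) = path_series ps * path_series qs"
  by (induction ps) (simp_all add: mult.assoc)

lemma path_series_inv:
  "path_series ps * path_series (path_inv ps) = 1"
proof (induction ps)
  case (Cons p ps)
  have "path_series (p # ps) * path_series (path_inv (p # ps)) =
      exp_letter (fst p) (snd p) * (path_series ps * path_series (path_inv ps)) * exp_letter (- fst p) (snd p)"
    by (simp add: path_inv_def path_series_append mult.assoc)
  then show ?case by (simp add: Cons exp_letter_add exp_letter_0)
qed (simp add: path_inv_def)

lemma order_ge_path_series: "order_ge 1 (path_series ps - 1)"
proof (induction ps)
  case (Cons p ps)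
  have "path_series (p # ps) - 1 = (exp_letter (fst p) (snd p) - 1) * path_series ps + (path_series ps - 1)"
    by (simp add: algebra_simps)
  moreover have "order_ge 1 ((exp_letter (fst p) (snd p) - 1) * path_series ps)"
    using order_ge_mult[OF order_ge_exp_letter(1) order_ge_0] by simp
  ultimately show ?case using order_ge_add Cons by metis
qed (simp add: order_ge_def zero_ncseries.rep_eq)

text \<open>Each further letter contributes one group commutator, which raises the order of the
  leading term and of the error by one.\<close>

lemma order_ge_bracket_path:
  "w \<noteq> [] \<Longrightarrow> order_ge (Suc (length w)) (path_series (bracket_path w) - 1 - bracket_series w)"
proof (induction w rule: bracket_path.induct)
  case (2 j)
  then show ?case using order_ge_exp_letter(2)[of j] by (simp add: numeral_2_eq_2)
next
  case (3 j i v)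
  let ?v = "i # v"
  have "order_ge (Suc (Suc (length ?v)))
    (exp_letter 1 j * path_series (bracket_path ?v) * exp_letter (-1) j * path_series (path_inv (bracket_path ?v))
      - 1 - (letter j * bracket_series ?v - bracket_series ?v * letter j))"
    using 3 by (intro order_ge_group_commutator order_ge_letter order_ge_exp_letter order_ge_bracket_series
        path_series_inv order_ge_path_series) (simp_all add: exp_letter_add exp_letter_0)
  then show ?case by (simp add: path_series_append mult.assoc)
qed simp

lemma set_bracket_path: "snd ` set (bracket_path w) \<subseteq> set w"
  by (induction w rule: bracket_path.induct) (auto simp: path_inv_def)

section \<open>Expansion along a path\<close>

definition words_le :: "nat \<Rightarrow> nat \<Rightarrow> nat list set" where
  "words_le m K = {w. set w \<subseteq> {1..m} \<and> length w \<le> K}"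

lemma finite_words_le: "finite (words_le m K)"
  unfolding words_le_def by (rule finite_lists_length_le) simp

text \<open>The differential operator obtained by substituting \<open>t\<close> times the Lie
  derivative along field \<open>j\<close> for the letter \<open>j\<close>, truncated at degree
  \<open>K\<close>.\<close>

definition series_sum ::
  "nat \<Rightarrow> (nat \<Rightarrow> 'a::euclidean_space \<Rightarrow> 'a) \<Rightarrow> nat \<Rightarrow> ncseries \<Rightarrow> ('a \<Rightarrow> 'b::euclidean_space) \<Rightarrow> real \<Rightarrow> 'a \<Rightarrow> 'b" where
  "series_sum m f K c g t x = (\<Sum>u\<in>words_le m K. (t ^ length u * coef c u) *\<^sub>R hder f u g x)"

lemma series_sum_one: "series_sum m f K 1 g t x = g x"
proof -
  have "series_sum m f K 1 g t x = (\<Sum>u\<in>{[]}. (t ^ length u * coef 1 u) *\<^sub>R hder f u g x)"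
    unfolding series_sum_def
    by (rule sum.mono_neutral_right[OF finite_words_le]) (auto simp: words_le_def one_ncseries.rep_eq)
  then show ?thesis by (simp add: one_ncseries.rep_eq)
qed

text \<open>Cut each word into a power of \<open>j\<close> and a tail \<open>v\<close>. Grouping by
  \<open>v\<close> produces the Taylor polynomial of \<open>hder f v g\<close> of degree
  \<open>K - length v\<close> along field \<open>j\<close>, the one estimated in
  \<open>flow_taylor\<close>.\<close>

lemma series_sum_exp_letter_mult:
  assumes j: "j \<in> {1..m}"
  shows "series_sum m f K (exp_letter r j * c) g t x =
    (\<Sum>v\<in>words_le m K. (t ^ length v * coef c v) *\<^sub>R
      (\<Sum>k\<le>K - length v. ((t * r) ^ k / fact k) *\<^sub>R hder f (replicate k j) (hder f v g) x))"
proof -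
  let ?F = "\<lambda>v k. (t ^ length v * coef c v) *\<^sub>R ((t * r) ^ k / fact k) *\<^sub>R hder f (replicate k j) (hder f v g) x"
  let ?G = "\<lambda>u i. (t ^ length u * (coef (exp_letter r j) (take i u) * coef c (drop i u))) *\<^sub>R hder f u g x"
  let ?A = "SIGMA u:words_le m K. {..length u}"
  \<comment> \<open>Only prefixes that are powers of \<open>j\<close> survive. Such a pair is
    recovered from its tail and the length of the prefix; a word alone may admit several
    cuts.\<close>
  let ?B = "{(u, i). (u, i) \<in> ?A \<and> set (take i u) \<subseteq> {j}}"
  let ?C = "SIGMA v:words_le m K. {..K - length v}"
  have finA: "finite ?A" by (intro finite_SigmaI finite_words_le) auto
  have "series_sum m f K (exp_letter r j * c) g t x = (\<Sum>u\<in>words_le m K. \<Sum>i\<le>length u. ?G u i)"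
    by (simp add: series_sum_def times_ncseries.rep_eq sum_distrib_left scaleR_sum_left)
  also have "\<dots> = (\<Sum>(u, i)\<in>?A. ?G u i)"
    by (rule sum.Sigma[OF finite_words_le]) simp
  also have "\<dots> = (\<Sum>(u, i)\<in>?B. ?G u i)"
    by (rule sum.mono_neutral_right[OF finA]) (auto simp: coef_exp_letter split: if_splits)
  also have "\<dots> = (\<Sum>(v, k)\<in>?C. ?F v k)"
  proof (rule sum.reindex_bij_witness[where i = "\<lambda>(v, k). (replicate k j @ v, k)" and j = "\<lambda>(u, i). (drop i u, i)"])
    fix a assume "a \<in> ?B"
    then obtain u i where a: "a = (u, i)" and u: "u \<in> words_le m K" and i: "i \<le> length u"
      and s: "set (take i u) \<subseteq> {j}" by auto
    have rep: "take i u = replicate i j"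
      using s i by (intro replicate_eqI) auto
    then have ui: "replicate i j @ drop i u = u"
      by (metis append_take_drop_id)
    then show "(case (case a of (u, i) \<Rightarrow> (drop i u, i)) of (v, k) \<Rightarrow> (replicate k j @ v, k)) = a"
      by (simp add: a)
    show "(case a of (u, i) \<Rightarrow> (drop i u, i)) \<in> ?C"
      using u i set_drop_subset[of i u] by (auto simp: a words_le_def)
    have "hder f u g x = hder f (replicate i j) (hder f (drop i u) g) x"
      using ui by (metis hder_append)
    moreover have "t ^ length u = t ^ length (drop i u) * t ^ i"
      using i by (simp flip: power_add)
    moreover have "coef (exp_letter r j) (take i u) = r ^ i / fact i"
      by (auto simp: rep coef_exp_letter)
    ultimately show "(case case a of (u, i) \<Rightarrow> (drop i u, i) of (v, k) \<Rightarrow> ?F v k) = (case a of (u, i) \<Rightarrow> ?G u i)"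
      by (simp add: a power_mult_distrib mult_ac)
  next
    fix b assume "b \<in> ?C"
    then obtain v k where b: "b = (v, k)" and v: "v \<in> words_le m K" and k: "k \<le> K - length v" by auto
    show "(case (case b of (v, k) \<Rightarrow> (replicate k j @ v, k)) of (u, i) \<Rightarrow> (drop i u, i)) = b"
      by (simp add: b)
    have "replicate k j @ v \<in> words_le m K"
      using v k j by (auto simp: words_le_def)
    then show "(case b of (v, k) \<Rightarrow> (replicate k j @ v, k)) \<in> ?B"
      by (auto simp: b)
  qed
  also have "\<dots> = (\<Sum>v\<in>words_le m K. \<Sum>k\<le>K - length v. ?F v k)"
    by (rule sum.Sigma[symmetric, OF finite_words_le]) simp
  finally show ?thesis by (simp add: scaleR_sum_right)
qed

text \<open>Induction on the legs. The rest of the path is expanded at the point reached by the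
  first leg, and each \<open>hder f v g\<close> there is replaced by its Taylor polynomial at the
  starting point. The error of order K - |v| + 1 carries a factor t^|v|, so every term is
  O(t^(K+1)). \<open>R\<close> varies because a leg may leave the ball by 1.\<close>

lemma path_expansion:
  fixes f :: "nat \<Rightarrow> 'a::euclidean_space \<Rightarrow> 'a" and g :: "'a \<Rightarrow> 'b::euclidean_space"
  assumes f: "\<And>j. j \<in> {1..m} \<Longrightarrow> C1 (f j)" and CH: "CH m f K g" and "snd ` set ps \<subseteq> {1..m}"
  shows "\<exists>\<delta>>0. \<exists>C. \<forall>x\<in>cball 0 R. \<forall>t. \<bar>t\<bar> < \<delta> \<longrightarrow>
    norm (g (path_flow f ps t x) - series_sum m f K (path_series ps) g t x) \<le> C * \<bar>t\<bar> ^ Suc K"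
  using assms(3)
proof (induction ps arbitrary: R)
  case Nil
  show ?case
    by (rule exI[of _ 1]) (auto simp: series_sum_one intro!: exI[of _ 0])
next
  case (Cons p ps)
  obtain r j where p: "p = (r, j)" by fastforce
  then have j: "j \<in> {1..m}" using Cons.prems by auto
  obtain \<delta>1 C1 where 1: "\<delta>1 > 0" "\<forall>x\<in>cball 0 (R + 1). \<forall>t. \<bar>t\<bar> < \<delta>1 \<longrightarrow>
      norm (g (path_flow f ps t x) - series_sum m f K (path_series ps) g t x) \<le> C1 * \<bar>t\<bar> ^ Suc K"
    using Cons.IH[of "R + 1"] Cons.prems by auto
  let ?rem = "\<lambda>v s x. hder f v g (flow (f j) s x) -
      (\<Sum>k\<le>K - length v. (s ^ k / fact k) *\<^sub>R hder f (replicate k j) (hder f v g) x)"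
  define good where "good v d L \<longleftrightarrow> 0 < d \<and> 0 \<le> L \<and> (\<forall>x\<in>cball 0 R. \<forall>s. \<bar>s\<bar> < d \<longrightarrow>
      flow (f j) s x \<in> cball 0 (R + 1) \<and> norm (?rem v s x) \<le> L * \<bar>s\<bar> ^ Suc (K - length v))" for v d L
  have "\<exists>d L. good v d L" if "v \<in> words_le m K" for v
    unfolding good_def
    by (rule flow_taylor[OF f[OF j] j CH_hder[OF CH]]) (use that in \<open>auto simp: words_le_def\<close>)
  then obtain \<delta>2 L where good: "\<And>v. v \<in> words_le m K \<Longrightarrow> good v (\<delta>2 v) (L v)"
    by metis
  have 2: "0 < \<delta>2 v" if "v \<in> words_le m K" for v
    using good[OF that] by (simp add: good_def)
  have 3: "flow (f j) s x \<in> cball 0 (R + 1)" "norm (?rem v s x) \<le> L v * \<bar>s\<bar> ^ Suc (K - length v)"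
    if "v \<in> words_le m K" "x \<in> cball 0 R" "\<bar>s\<bar> < \<delta>2 v" for v x s
    using good[OF that(1)] that(2,3) by (simp_all add: good_def del: power_Suc)
  \<comment> \<open>Division by \<open>\<bar>r\<bar> + 1\<close> ensures that
    \<open>\<bar>t * r\<bar>\<close> is below each \<open>\<delta>2 v\<close>, including the case
    \<open>r = 0\<close>.\<close>
  define \<delta> where "\<delta> = Min (insert \<delta>1 ((\<lambda>v. \<delta>2 v / (\<bar>r\<bar> + 1)) ` words_le m K))"
  have "\<delta> > 0" unfolding \<delta>_def
    by (subst Min_gr_iff) (use 1 2 finite_words_le in \<open>auto intro!: divide_pos_pos\<close>)
  have d1: "\<delta> \<le> \<delta>1" and d2: "\<And>v. v \<in> words_le m K \<Longrightarrow> \<delta> \<le> \<delta>2 v / (\<bar>r\<bar> + 1)"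
    unfolding \<delta>_def by (auto intro!: Min_le finite_imageI finite_words_le)
  let ?c = "path_series ps"
  define C where "C = C1 + (\<Sum>v\<in>words_le m K. \<bar>coef ?c v\<bar> * L v * \<bar>r\<bar> ^ Suc (K - length v))"
  show ?case
  proof (rule exI[of _ \<delta>], rule conjI[OF \<open>\<delta> > 0\<close>], rule exI[of _ C], intro ballI allI impI)
    fix x :: 'a and t :: real assume x: "x \<in> cball 0 R" and t: "\<bar>t\<bar> < \<delta>"
    let ?y = "flow (f j) (t * r) x"
    have tr: "\<bar>t * r\<bar> < \<delta>2 v" if "v \<in> words_le m K" for v
    proof -
      have "\<bar>t * r\<bar> \<le> \<bar>t\<bar> * (\<bar>r\<bar> + 1)" by (simp add: abs_mult algebra_simps)
      also have "\<dots> < \<delta> * (\<bar>r\<bar> + 1)" using t by (intro mult_strict_right_mono) auto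
      also have "\<dots> \<le> \<delta>2 v" using d2[OF that] by (simp add: field_simps)
      finally show ?thesis .
    qed
    \<comment> \<open>The empty word supplies at least one \<open>\<delta>2 v\<close>, which keeps
      the flow in the larger ball.\<close>
    have "[] \<in> words_le m K" by (simp add: words_le_def)
    then have y: "?y \<in> cball 0 (R + 1)" using 3(1)[OF _ x tr] by blast
    have rem: "norm ((t ^ length v * coef ?c v) *\<^sub>R ?rem v (t * r) x)
        \<le> \<bar>coef ?c v\<bar> * L v * \<bar>r\<bar> ^ Suc (K - length v) * \<bar>t\<bar> ^ Suc K" if v: "v \<in> words_le m K" for v
    proof -
      have K: "\<bar>t\<bar> ^ Suc K = \<bar>t\<bar> ^ length v * \<bar>t\<bar> ^ Suc (K - length v)"
        using v by (simp add: words_le_def flip: power_add power_Suc)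
      have "norm ((t ^ length v * coef ?c v) *\<^sub>R ?rem v (t * r) x)
          \<le> \<bar>t ^ length v * coef ?c v\<bar> * (L v * \<bar>t * r\<bar> ^ Suc (K - length v))"
        unfolding norm_scaleR by (intro mult_left_mono 3(2) v x tr abs_ge_zero)
      also have "\<dots> = \<bar>coef ?c v\<bar> * L v * \<bar>r\<bar> ^ Suc (K - length v) * \<bar>t\<bar> ^ Suc K"
        unfolding K by (simp add: abs_mult power_abs power_mult_distrib mult_ac del: power_Suc)
      finally show ?thesis .
    qed
    have "series_sum m f K ?c g t ?y - series_sum m f K (path_series (p # ps)) g t x =
        (\<Sum>v\<in>words_le m K. (t ^ length v * coef ?c v) *\<^sub>R ?rem v (t * r) x)"
      by (simp add: p series_sum_exp_letter_mult[OF j]) (simp add: series_sum_def scaleR_diff_right sum_subtractf)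
    then have "g (path_flow f (p # ps) t x) - series_sum m f K (path_series (p # ps)) g t x =
        (g (path_flow f ps t ?y) - series_sum m f K ?c g t ?y) +
        (\<Sum>v\<in>words_le m K. (t ^ length v * coef ?c v) *\<^sub>R ?rem v (t * r) x)"
      by (simp add: p diff_eq_eq del: path_series.simps)
    also have "norm \<dots> \<le>
        C1 * \<bar>t\<bar> ^ Suc K + (\<Sum>v\<in>words_le m K. \<bar>coef ?c v\<bar> * L v * \<bar>r\<bar> ^ Suc (K - length v) * \<bar>t\<bar> ^ Suc K)"
      by (intro norm_triangle_le add_mono sum_norm_le rem) (use 1 y t d1 in auto)
    also have "\<dots> = C * \<bar>t\<bar> ^ Suc K"
      by (simp add: C_def distrib_right sum_distrib_right)
    finally show "norm (g (path_flow f (p # ps) t x) - series_sum m f K (path_series (p # ps)) g t x) \<le> C * \<bar>t\<bar> ^ Suc K" .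
  qed
qed

text \<open>The series of the bracket path vanishes in degrees 1 to l - 1 and equals the bracket
  series in degree \<open>l\<close>, which evaluates to the permutation sum. After division by t^l
  the higher degrees and the remainder O(t^(K+1)) tend to 0.\<close>

lemma bracket_path_leading_term:
  fixes f :: "nat \<Rightarrow> 'a::euclidean_space \<Rightarrow> 'a" and g :: "'a \<Rightarrow> 'b::euclidean_space"
  assumes f: "\<And>j. j \<in> {1..m} \<Longrightarrow> C1 (f j)" and CH: "CH m f K g"
    and w: "w \<in> words m l" "1 \<le> l" "l \<le> K"
  shows "((\<lambda>t. (1 / t ^ l) *\<^sub>R (g (path_flow f (bracket_path w) t x) - g x)) \<longlongrightarrow> Xw_sharp f w g x) (at 0)"
proof -
  have len: "length w = l" "w \<noteq> []" "set w \<subseteq> {1..m}" using w by (auto simp: words_def)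
  let ?P = "bracket_path w" and ?W = "words_le m K"
  let ?c = "path_series ?P"
  have c: "coef ?c u = (if u = [] then 1 else 0) + coef (bracket_series w) u" if "length u \<le> l" for u
    using order_ge_bracket_path[OF len(2)] that len(1)
    by (auto simp: order_ge_def coef_ring_simps diff_eq_eq le_imp_less_Suc split: if_splits)
  have c0: "coef ?c u = (if u = [] then 1 else 0)" if "length u < l" for u
    using c[of u] that order_ge_bracket_series[of w] len(1) by (simp add: order_ge_def)
  have cl: "coef ?c u = coef (bracket_series w) u" if "length u = l" for u
    using c[of u] that w(2) by auto
  obtain \<delta> C where dC: "\<delta> > 0" "\<forall>x\<in>cball 0 (norm x). \<forall>t. \<bar>t\<bar> < \<delta> \<longrightarrow>
      norm (g (path_flow f ?P t x) - series_sum m f K ?c g t x) \<le> C * \<bar>t\<bar> ^ Suc K"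
    using path_expansion[OF f CH, of ?P "norm x"] set_bracket_path[of w] len(3) by blast
  \<comment> \<open>The truncated series without its constant term, divided by t^l. Only nonnegative
    powers of \<open>t\<close> remain, so the limit at 0 can be taken term by term.\<close>
  let ?a = "\<lambda>t. \<Sum>u\<in>?W. (if length u < l then 0 else t ^ (length u - l) * coef ?c u) *\<^sub>R hder f u g x"
  have "(?a \<longlongrightarrow> (\<Sum>u\<in>?W. (if length u < l then 0 else 0 ^ (length u - l) * coef ?c u) *\<^sub>R hder f u g x)) (at 0)"
  proof (intro tendsto_sum tendsto_scaleR tendsto_const)
    fix u
    show "((\<lambda>t. if length u < l then 0 else t ^ (length u - l) * coef ?c u) \<longlongrightarrow>
        (if length u < l then 0 else 0 ^ (length u - l) * coef ?c u)) (at 0)"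
      by (cases "length u < l") (simp_all add: tendsto_mult_right tendsto_power)
  qed
  \<comment> \<open>The power \<open>0 ^ (length u - l)\<close> is 1 for words of length
    \<open>l\<close> and 0 for longer ones.\<close>
  also have "(\<Sum>u\<in>?W. (if length u < l then 0 else 0 ^ (length u - l) * coef ?c u) *\<^sub>R hder f u g x)
      = (\<Sum>u\<in>words m l. coef (bracket_series w) u *\<^sub>R hder f u g x)"
    by (rule sum.mono_neutral_cong_right[OF finite_words_le])
       (use w(3) in \<open>auto simp: words_le_def words_def cl\<close>)
  also have "\<dots> = Xw_sharp f w g x"
    unfolding Xw_sharp_def len(1)[symmetric] by (rule sum_words_bracket_series[OF len(2,3)])
  finally have lim: "(?a \<longlongrightarrow> Xw_sharp f w g x) (at 0)" .
  have a: "(1 / t ^ l) *\<^sub>R (series_sum m f K ?c g t x - g x) = ?a t" if "t \<noteq> 0" for t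
  proof -
    have "series_sum m f K ?c g t x - g x = series_sum m f K ?c g t x - series_sum m f K 1 g t x"
      by (simp add: series_sum_one)
    also have "\<dots> = (\<Sum>u\<in>?W. (t ^ length u * (coef ?c u - coef 1 u)) *\<^sub>R hder f u g x)"
      by (simp add: series_sum_def sum_subtractf[symmetric] algebra_simps)
    also have "(1 / t ^ l) *\<^sub>R \<dots> = ?a t"
      unfolding scaleR_sum_right
    proof (rule sum.cong[OF refl])
      fix u
      show "(1 / t ^ l) *\<^sub>R (t ^ length u * (coef ?c u - coef 1 u)) *\<^sub>R hder f u g x =
          (if length u < l then 0 else t ^ (length u - l) * coef ?c u) *\<^sub>R hder f u g x"
      proof (cases "length u < l")
        case True
        then show ?thesis by (simp add: c0 one_ncseries.rep_eq)
      next
        case False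
        then have "u \<noteq> []" "t ^ length u = t ^ l * t ^ (length u - l)"
          using w(2) by (auto simp flip: power_add)
        then show ?thesis using False that by (simp add: one_ncseries.rep_eq)
      qed
    qed
    finally show ?thesis .
  qed
  have "((\<lambda>t. (1 / t ^ l) *\<^sub>R (g (path_flow f ?P t x) - g x) - ?a t) \<longlongrightarrow> 0) (at 0)"
  proof (rule Lim_null_comparison)
    show "\<forall>\<^sub>F t in at 0. norm ((1 / t ^ l) *\<^sub>R (g (path_flow f ?P t x) - g x) - ?a t) \<le> \<bar>C\<bar> * \<bar>t\<bar> ^ (Suc K - l)"
      unfolding eventually_at
    proof (rule exI[of _ \<delta>], intro conjI dC(1) ballI impI)
      fix t :: real assume "t \<noteq> 0 \<and> dist t 0 < \<delta>"
      then have t: "t \<noteq> 0" "\<bar>t\<bar> < \<delta>" by auto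
      have "(1 / t ^ l) *\<^sub>R (g (path_flow f ?P t x) - g x) - ?a t =
          (1 / t ^ l) *\<^sub>R (g (path_flow f ?P t x) - series_sum m f K ?c g t x)"
        unfolding a[OF t(1), symmetric] by (simp add: algebra_simps)
      also have "norm \<dots> \<le> (1 / \<bar>t\<bar> ^ l) * (\<bar>C\<bar> * \<bar>t\<bar> ^ Suc K)"
      proof -
        have "norm (g (path_flow f ?P t x) - series_sum m f K ?c g t x) \<le> C * \<bar>t\<bar> ^ Suc K"
          using dC(2) t(2) by simp
        also have "\<dots> \<le> \<bar>C\<bar> * \<bar>t\<bar> ^ Suc K" by (intro mult_right_mono) auto
        finally show ?thesis by (simp add: power_abs divide_right_mono)
      qed
      also have "\<bar>t\<bar> ^ Suc K = \<bar>t\<bar> ^ l * \<bar>t\<bar> ^ (Suc K - l)"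
        using w(3) by (simp flip: power_add power_Suc)
      finally show "norm ((1 / t ^ l) *\<^sub>R (g (path_flow f ?P t x) - g x) - ?a t) \<le> \<bar>C\<bar> * \<bar>t\<bar> ^ (Suc K - l)"
        using t(1) by simp
    qed
    have "((\<lambda>t. \<bar>C\<bar> * \<bar>t\<bar> ^ (Suc K - l)) \<longlongrightarrow> \<bar>C\<bar> * \<bar>0\<bar> ^ (Suc K - l)) (at (0::real))"
      by (intro tendsto_intros)
    then show "((\<lambda>t. \<bar>C\<bar> * \<bar>t\<bar> ^ (Suc K - l)) \<longlongrightarrow> 0) (at (0::real))"
      using w(3) by (simp add: power_0_left Suc_diff_le)
  qed
  from tendsto_add[OF this lim] show ?thesis by simp
qed

section \<open>Comparison with the Euclidean derivative\<close>

text \<open>A chain rule for points approaching \<open>x\<close> at rate \<open>q\<close>, based on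
  convergence of the rescaled displacement. It is applied with \<open>q\<close> equal to
  t^l.\<close>

lemma has_derivative_along_scaled:
  fixes \<psi> :: "'a::real_normed_vector \<Rightarrow> 'b::real_normed_vector" and y :: "real \<Rightarrow> 'a"
  assumes D: "(\<psi> has_derivative D) (at x)"
    and y: "((\<lambda>t. (1 / q t) *\<^sub>R (y t - x)) \<longlongrightarrow> v) (at 0)"
    and q: "(q \<longlongrightarrow> 0) (at 0)" "\<And>t. t \<noteq> 0 \<Longrightarrow> q t \<noteq> (0::real)"
  shows "((\<lambda>t. (1 / q t) *\<^sub>R (\<psi> (y t) - \<psi> x)) \<longlongrightarrow> D v) (at 0)"
proof -
  have bl: "bounded_linear D" using D by (rule has_derivative_bounded_linear)
  \<comment> \<open>The first-order error relative to the distance. Division by 0 gives 0, so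
    \<open>e\<close> vanishes at \<open>x\<close> and is continuous there, which covers times with
    \<open>y t = x\<close>.\<close>
  define e where "e z = (1 / norm (z - x)) *\<^sub>R (\<psi> z - \<psi> x - D (z - x))" for z
  have "((\<lambda>t. q t *\<^sub>R ((1 / q t) *\<^sub>R (y t - x)) + x) \<longlongrightarrow> 0 *\<^sub>R v + x) (at 0)"
    by (intro tendsto_intros y q)
  moreover have "\<forall>\<^sub>F t in at 0. q t *\<^sub>R ((1 / q t) *\<^sub>R (y t - x)) + x = y t"
    by (auto simp: eventually_at_filter q(2))
  ultimately have yx: "(y \<longlongrightarrow> x) (at 0)"
    using tendsto_cong by fastforce
  have "(e \<longlongrightarrow> 0) (at x)"
    using D unfolding has_derivative_at_within e_def by (simp add: divide_inverse)
  then have "(e \<longlongrightarrow> e x) (at x)" by (simp add: e_def)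
  then have ey: "((\<lambda>t. e (y t)) \<longlongrightarrow> 0) (at 0)"
    using isCont_tendsto_compose[OF _ yx, of e] by (simp add: isCont_def e_def)
  \<comment> \<open>The sign of \<open>q t\<close> converts the factor
    \<open>1 / \<bar>q t\<bar>\<close> coming from the norm into \<open>1 / q t\<close>; having
    modulus 1, it does not affect convergence to 0.\<close>
  have "((\<lambda>t. D ((1 / q t) *\<^sub>R (y t - x)) + (q t / \<bar>q t\<bar>) *\<^sub>R (norm ((1 / q t) *\<^sub>R (y t - x)) *\<^sub>R e (y t))) \<longlongrightarrow> D v + 0) (at 0)"
  proof (intro tendsto_add)
    show "((\<lambda>t. D ((1 / q t) *\<^sub>R (y t - x))) \<longlongrightarrow> D v) (at 0)"
      using bounded_linear.tendsto[OF bl y] .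
    have "((\<lambda>t. norm ((1 / q t) *\<^sub>R (y t - x)) *\<^sub>R e (y t)) \<longlongrightarrow> norm v *\<^sub>R 0) (at 0)"
      by (intro tendsto_intros y ey)
    then have *: "((\<lambda>t. norm (norm ((1 / q t) *\<^sub>R (y t - x)) *\<^sub>R e (y t))) \<longlongrightarrow> 0) (at 0)"
      by (intro tendsto_norm_zero) simp
    show "((\<lambda>t. (q t / \<bar>q t\<bar>) *\<^sub>R (norm ((1 / q t) *\<^sub>R (y t - x)) *\<^sub>R e (y t))) \<longlongrightarrow> 0) (at 0)"
      by (rule Lim_null_comparison[OF _ *]) (auto simp: eventually_at_filter q(2))
  qed
  moreover have "\<forall>\<^sub>F t in at 0. D ((1 / q t) *\<^sub>R (y t - x)) + (q t / \<bar>q t\<bar>) *\<^sub>R (norm ((1 / q t) *\<^sub>R (y t - x)) *\<^sub>R e (y t)) =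
      (1 / q t) *\<^sub>R (\<psi> (y t) - \<psi> x)"
  proof -
    have "D ((1 / q t) *\<^sub>R (y t - x)) + (q t / \<bar>q t\<bar>) *\<^sub>R (norm ((1 / q t) *\<^sub>R (y t - x)) *\<^sub>R e (y t)) =
      (1 / q t) *\<^sub>R (\<psi> (y t) - \<psi> x)" if t: "t \<noteq> 0" for t
    proof (cases "y t = x")
      case True
      then show ?thesis by (simp add: linear_0[OF bounded_linear.linear[OF bl]])
    next
      case False
      have "(q t / \<bar>q t\<bar>) *\<^sub>R (norm ((1 / q t) *\<^sub>R (y t - x)) *\<^sub>R e (y t)) =
          (q t / \<bar>q t\<bar> * (1 / \<bar>q t\<bar>)) *\<^sub>R (\<psi> (y t) - \<psi> x - D (y t - x))"
        using False by (simp add: e_def)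
      also have "q t / \<bar>q t\<bar> * (1 / \<bar>q t\<bar>) = 1 / q t"
        using q(2)[OF t] by (simp add: abs_if)
      finally have E: "(q t / \<bar>q t\<bar>) *\<^sub>R (norm ((1 / q t) *\<^sub>R (y t - x)) *\<^sub>R e (y t)) =
          (1 / q t) *\<^sub>R (\<psi> (y t) - \<psi> x - D (y t - x))" .
      show ?thesis
        unfolding E linear_cmul[OF bounded_linear.linear[OF bl]] by (simp add: scaleR_diff_right)
    qed
    then show ?thesis by (simp add: eventually_at_filter)
  qed
  ultimately show ?thesis by (simp add: tendsto_cong)
qed

text \<open>In every permuted word the last letter acts first on the identity and returns its
  coefficient function. The expansion for functions thereby also describes the displacement of the
  point.\<close>

lemma Xw_sharp_id:
  assumes "\<And>j. j \<in> {1..m} \<Longrightarrow> C1 (f j)" "w \<noteq> []" "set w \<subseteq> {1..m}"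
  shows "Xw_sharp f w (\<lambda>x. x) = comm_coeff f w"
proof
  fix x
  have "hder f (perm_word \<sigma> w) (\<lambda>x. x) x = hder f (butlast (perm_word \<sigma> w)) (f (last (perm_word \<sigma> w))) x"
    if \<sigma>: "\<sigma> permutes {1..length w}" for \<sigma>
  proof -
    have ne: "perm_word \<sigma> w \<noteq> []" using assms(2) by (cases w) (simp_all add: perm_word_def)
    have "set (perm_word \<sigma> w) \<subseteq> set w"
    proof
      fix a assume "a \<in> set (perm_word \<sigma> w)"
      then obtain i where "i \<in> set [1..<Suc (length w)]" and a: "a = w ! (\<sigma> i - 1)"
        unfolding perm_word_def set_map by blast
      then have "i \<in> {1..length w}" by auto
      then have "\<sigma> i \<in> {1..length w}" using permutes_in_image[OF \<sigma>] by blast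
      then show "a \<in> set w" using a by auto
    qed
    then have "last (perm_word \<sigma> w) \<in> {1..m}" using last_in_set[OF ne] assms(3) by blast
    then have "lie_deriv (f (last (perm_word \<sigma> w))) (\<lambda>x. x) = f (last (perm_word \<sigma> w))"
      by (intro lie_deriv_id assms(1))
    then have "hder f (butlast (perm_word \<sigma> w) @ [last (perm_word \<sigma> w)]) (\<lambda>x. x) =
        hder f (butlast (perm_word \<sigma> w)) (f (last (perm_word \<sigma> w)))"
      by (simp add: hder_append)
    then show ?thesis by (simp add: ne)
  qed
  then show "Xw_sharp f w (\<lambda>x. x) x = comm_coeff f w x"
    unfolding Xw_sharp_def comm_coeff_def by (intro sum.cong) auto
qed

text \<open>The identity gains one order: its innermost derivative along field \<open>j\<close> is
  \<open>f j\<close>, and the other \<open>k\<close> derivatives fall on that.\<close>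

lemma CH_id:
  assumes "\<And>j. j \<in> {1..m} \<Longrightarrow> C1 (f j) \<and> CH m f k (f j)"
  shows "CH m f (Suc k) (\<lambda>x. x)"
  unfolding CH_def
proof
  fix w assume "w \<in> words m (Suc k)"
  then obtain u j where w: "w = u @ [j]" "u \<in> words m k" "j \<in> {1..m}"
    by (cases w rule: rev_cases) (auto simp: words_def)
  have f: "C1 (f j)" "CH m f k (f j)" using assms w(3) by auto
  have "hder_exists f [j] (\<lambda>x. x)" using has_lie_deriv_id[OF f(1)] by auto
  then show "hder_exists f w (\<lambda>x. x) \<and> (\<forall>A. bounded A \<longrightarrow> d_lipschitz_on m f A (hder f w (\<lambda>x. x)))"
    using f(2) w by (auto simp: CH_def hder_append hder_exists_append lie_deriv_id[OF f(1)])
qed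

text \<open>One limit evaluated twice: through differentiability of \<open>\<psi>\<close> with the
  expansion of the identity, and through the horizontal expansion of \<open>\<psi>\<close>
  itself.\<close>

lemma Xw_eq_Xw_sharp:
  fixes f :: "nat \<Rightarrow> 'a::euclidean_space \<Rightarrow> 'a" and \<psi> :: "'a \<Rightarrow> 'b::euclidean_space"
  assumes f: "\<And>j. j \<in> {1..m} \<Longrightarrow> C1 (f j) \<and> CH m f k (f j)"
    and w: "w \<in> words m l" "1 \<le> l" "l \<le> Suc k" and \<psi>: "C1 \<psi>" "CH m f l \<psi>"
  shows "Xw f w \<psi> = Xw_sharp f w \<psi>"
proof
  fix x
  have C: "\<And>j. j \<in> {1..m} \<Longrightarrow> C1 (f j)" using f by blast
  let ?y = "\<lambda>t. path_flow f (bracket_path w) t x"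
  have "((\<lambda>t. (1 / t ^ l) *\<^sub>R (?y t - x)) \<longlongrightarrow> Xw_sharp f w (\<lambda>x. x) x) (at 0)"
    by (rule bracket_path_leading_term[OF C CH_id[OF f] w])
  moreover have "Xw_sharp f w (\<lambda>x. x) = comm_coeff f w"
    using w by (intro Xw_sharp_id[of m] C) (auto simp: words_def)
  ultimately have y: "((\<lambda>t. (1 / t ^ l) *\<^sub>R (?y t - x)) \<longlongrightarrow> comm_coeff f w x) (at 0)" by simp
  have "\<psi> differentiable (at x)"
    using \<psi>(1) by (auto simp: C1_def differentiable_def)
  then have D: "(\<psi> has_derivative frechet_derivative \<psi> (at x)) (at x)"
    by (simp add: frechet_derivative_works)
  have "((\<lambda>t::real. t ^ l) \<longlongrightarrow> 0 ^ l) (at 0)" by (intro tendsto_intros)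
  then have t0: "((\<lambda>t::real. t ^ l) \<longlongrightarrow> 0) (at 0)" using w(2) by simp
  have "((\<lambda>t. (1 / t ^ l) *\<^sub>R (\<psi> (?y t) - \<psi> x)) \<longlongrightarrow> frechet_derivative \<psi> (at x) (comm_coeff f w x)) (at 0)"
    by (rule has_derivative_along_scaled[OF D y t0]) simp
  moreover have "((\<lambda>t. (1 / t ^ l) *\<^sub>R (\<psi> (?y t) - \<psi> x)) \<longlongrightarrow> Xw_sharp f w \<psi> x) (at 0)"
    by (rule bracket_path_leading_term[OF C \<psi>(2) w(1,2) order_refl])
  ultimately show "Xw f w \<psi> x = Xw_sharp f w \<psi> x"
    unfolding Xw_def vf_apply_def by (rule tendsto_unique[rotated]) simp
qed

theorem theorem3p1:
  fixes f :: "nat \<Rightarrow> real ^ 'n \<Rightarrow> real ^ 'n" and m s l :: nat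
  assumes "\<forall>j\<in>{1..m}. C1 (f j) \<and> CH m f (s - 1) (f j)"
    and "1 \<le> l" and "l \<le> s - 1"
  shows "let
      i = (\<forall>w\<in>words m l. \<forall>\<psi> :: real ^ 'n \<Rightarrow> real. C1 \<psi> \<and> CH m f l \<psi> \<longrightarrow>
             Xw f w \<psi> = Xw_sharp f w \<psi>);
      ii = (\<forall>\<psi> :: real ^ 'n \<Rightarrow> real ^ 'n. C1 \<psi> \<and> CH m f l \<psi> \<longrightarrow>
             (\<forall>w\<in>words m l. \<forall>\<phi> :: real ^ 'n \<Rightarrow> real. C1 \<phi> \<longrightarrow>
                vf_apply (ad_coeff f \<psi> w) \<phi> = vf_apply (bracket_coeff f \<psi> w) \<phi>))
    in (i \<longleftrightarrow> ii) \<and> i \<and> ii"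
proof -
  have f: "\<And>j. j \<in> {1..m} \<Longrightarrow> C1 (f j) \<and> CH m f (s - 1) (f j)"
    using assms(1) by blast
  \<comment> \<open>The value type stays open here: scalar functions give (i), vector-valued ones
    serve (ii).\<close>
  note eq = Xw_eq_Xw_sharp[OF f _ assms(2) le_SucI[OF assms(3)]]
  have i: "Xw f w \<psi> = Xw_sharp f w \<psi>"
    if "w \<in> words m l" "C1 \<psi>" "CH m f l \<psi>" for w and \<psi> :: "real ^ 'n \<Rightarrow> real"
    by (rule eq[OF _ that])
  have "Xw f w \<psi> = Xw_sharp f w \<psi>"
    if "w \<in> words m l" "C1 \<psi>" "CH m f l \<psi>" for w and \<psi> :: "real ^ 'n \<Rightarrow> real ^ 'n"
    by (rule eq[OF _ that])
  \<comment> \<open>The Lie derivative along \<open>\<psi>\<close> enters both coefficients alike,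
    so only the vector-valued identity remains.\<close>
  then have ii: "ad_coeff f \<psi> w = bracket_coeff f \<psi> w"
    if "w \<in> words m l" "C1 \<psi>" "CH m f l \<psi>" for w and \<psi> :: "real ^ 'n \<Rightarrow> real ^ 'n"
    using that by (simp add: fun_eq_iff ad_coeff_def bracket_coeff_def)
  show ?thesis
    unfolding Let_def by (simp add: i ii)
qed

end
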